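(* Let $R_0>0$, let $D \subset \mathbf{R}^2$ be the (open) disk of radius $R_0$ centered at the origin, let $S := \partial D$ denote the boundary circle, and let $f \in C^{\infty}(\mathbf{R}^2)$ with $\operatorname{supp} f \subset \overline{D}$. Then, for every $x \in D$, $$f(x) = \frac{1}{2\pi R_0}\, \Delta_x \int_S \int_0^{2R_0} r\, (\mathcal{M} f)(p,r)\, \log\left| r^2 - |x-p|^2 \right| \, dr\, ds(p)$$ and $$f(x) = \frac{1}{2\pi R_0} \int_S \int_0^{2R_0} \left(\partial_r\, r\, \partial_r \mathcal{M} f\right)(p,r)\, \log\left| r^2 - |x-p|^2 \right| \, dr\, ds(p).$$
   Context: For $f\in C^\infty(\mathbf{R}^2)$, the circular mean transform is $(\mathcal{M} f)(x,r) = \frac{1}{2\pi}\int_{S^1} f(x+r\theta)\, ds(\theta)$ for $(x,r)\in\mathbf{R}^2\times[0,\infty)$, where $S^1$ is the unit circle and $ds$ denotes arc length measure (on $S^1$ and on $S$). Here $\partial_r\, r\, \partial_r \mathcal{M} f$ denotes the composition of operators in the second variable: $(\partial_r\, r\, \partial_r \mathcal{M} f)(p,r) = \frac{\partial}{\partial r}\left( r \frac{\partial (\mathcal{M} f)}{\partial r}(p,r)\right)$. $\Delta_x$ is the Laplacian in $x$. *)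

theory Defs
  imports "HOL-Analysis.Analysis"
begin

definition partial_deriv :: "'n::finite \<Rightarrow> (real ^ 'n \<Rightarrow> real) \<Rightarrow> real ^ 'n \<Rightarrow> real" where
  "partial_deriv i f x = frechet_derivative f (at x) (axis i 1)"

text \<open>
  The classes \<open>C\<^sup>k(S)\<close> and \<open>C\<^sup>\<infinity>(S)\<close>, intended for open \<open>S\<close>.
\<close>

primrec Ck_on :: "nat \<Rightarrow> (real ^ 'n::finite) set \<Rightarrow> (real ^ 'n \<Rightarrow> real) \<Rightarrow> bool" where
  "Ck_on 0 S f \<longleftrightarrow> continuous_on S f"
| "Ck_on (Suc k) S f \<longleftrightarrow>
     (\<forall>x\<in>S. f differentiable (at x)) \<and> (\<forall>i. Ck_on k S (partial_deriv i f))"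

definition smooth_on :: "(real ^ 'n::finite) set \<Rightarrow> (real ^ 'n \<Rightarrow> real) \<Rightarrow> bool" where
  "smooth_on S f \<longleftrightarrow> (\<forall>k. Ck_on k S f)"

definition laplacian :: "(real ^ 'n::finite \<Rightarrow> real) \<Rightarrow> real ^ 'n \<Rightarrow> real" where
  "laplacian f x = (\<Sum>i\<in>UNIV. partial_deriv i (partial_deriv i f) x)"

text \<open>
  Arc length measure on the circle of radius \<open>R > 0\<close> about the origin, as a Borel measure on the
  plane concentrated on \<open>sphere 0 R\<close>: the image of Lebesgue measure on \<open>[0, 2 \<pi> R)\<close> under the
  unit-speed parametrization, which is injective on that interval.
\<close>

definition circle_arc_length :: "real \<Rightarrow> (real ^ 2) measure" where
  "circle_arc_length R =
     distr (restrict_space lborel {0..<2 * pi * R}) borel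
       (\<lambda>s. vector [R * cos (s / R), R * sin (s / R)])"

definition circular_mean :: "(real ^ 2 \<Rightarrow> real) \<Rightarrow> real ^ 2 \<Rightarrow> real \<Rightarrow> real" where
  "circular_mean f x r = 1 / (2 * pi) * (LINT \<theta>|circle_arc_length 1. f (x + r *\<^sub>R \<theta>))"

text \<open>
  Circular means are functions of a radius in \<open>[0, \<infinity>)\<close>, so \<open>\<partial>\<^sub>r\<close> is the derivative relative to
  that half-line (one-sided at \<open>0\<close>).
\<close>

definition radial_deriv :: "(real \<Rightarrow> real) \<Rightarrow> real \<Rightarrow> real" where
  "radial_deriv g r = vector_derivative g (at r within {0..})"

definition dr_r_dr :: "(real \<Rightarrow> real) \<Rightarrow> real \<Rightarrow> real" where
  "dr_r_dr g = radial_deriv (\<lambda>r. r * radial_deriv g r)"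

text \<open>
  Absolute convergence of the iterated integral of \<open>h p r\<close>, first over \<open>r \<in> [0, 2 R]\<close> and then
  over the circle of radius \<open>R\<close> with respect to arc length. Since Bochner integrals of
  non-integrable functions are \<open>0\<close> by convention, equations between integrals do not imply it.
\<close>

definition iterated_integrable :: "real \<Rightarrow> (real ^ 2 \<Rightarrow> real \<Rightarrow> real) \<Rightarrow> bool" where
  "iterated_integrable R h \<longleftrightarrow>
     (\<forall>p\<in>sphere 0 R. set_integrable lborel {0..2 * R} (h p)) \<and>
     integrable (circle_arc_length R) (\<lambda>p. LBINT r:{0..2 * R}. h p r)"

end

theory Submission
  imports Defs
begin

text \<open>
  Both formulas rest on one property of the circle \<open>S\<close> of radius \<open>R\<close>: for \<open>x\<close> in the open disk and
  \<open>y \<noteq> x\<close> in the closed disk,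
  \<open>\<integral>\<^sub>S log | |y-p|\<^sup>2 - |x-p|\<^sup>2 | ds(p) = 2 \<pi> R log (R |x-y|)\<close>,
  that is, averaging the kernel over the centres produces a multiple of the fundamental solution
  of the plane Laplacian, up to a constant (\<open>log_kernel_integral\<close>).
  The reason is that \<open>|y-p|\<^sup>2 - |x-p|\<^sup>2\<close> is an affine function of \<open>p\<close>, hence on the circle of the form
  \<open>2 R |x-y| (cos a - cos (t - b))\<close>; it has a real angle \<open>a\<close> because \<open>|x+y| \<le> 2 R\<close>. The difference of
  cosines is a product of two sines of half angles, so its logarithm splits into two full periods
  of \<open>log |sin|\<close>, each with mean \<open>- log 2\<close>.

  In polar coordinates about \<open>p\<close>, the inner integral of \<open>r (M g)(p,r) log |r\<^sup>2 - |x-p|\<^sup>2|\<close> is, up to the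
  factor \<open>2 \<pi>\<close>, the plane integral of \<open>g(y) log | |y-p|\<^sup>2 - |x-p|\<^sup>2 |\<close>. Exchanging the integrals over \<open>y\<close>
  and \<open>p\<close> gives \<open>R\<close> times the logarithmic potential \<open>\<integral> g(x+z) log (R |z|) dz\<close>, for every
  continuous \<open>g\<close> supported in the closed disk (\<open>circular_mean_log_integral\<close>).

  For the first formula take \<open>g = f\<close>. Derivatives of the potential fall on the density
  (\<open>kernel_integral_laplacian\<close>), so its Laplacian is the potential of \<open>\<Delta> f\<close>, and that equals \<open>2 \<pi> f\<close>
  (\<open>log_potential_laplacian\<close>): in polar coordinates about \<open>x\<close> the Darboux equation
  \<open>\<partial>\<^sub>r r \<partial>\<^sub>r M f = r M (\<Delta> f)\<close> (\<open>circular_mean_darboux\<close>) turns the integrand into a derivative.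
  For the second formula take \<open>g = \<Delta> f\<close>: by the Darboux equation the double integral is again
  \<open>R\<close> times the potential of \<open>\<Delta> f\<close>. The factor \<open>R\<close> inside the logarithm contributes nothing, because it is
  carried through the integration by parts, where it disappears with \<open>\<partial>\<^sub>r log (R r) = 1 / r\<close>.
\<close>

section \<open>Polar coordinates in the plane\<close>

definition unit_vec :: "real \<Rightarrow> real ^ 2" where
  "unit_vec t = vector [cos t, sin t]"

lemma unit_vec_nth [simp]: "unit_vec t $ 1 = cos t" "unit_vec t $ 2 = sin t"
  by (simp_all add: unit_vec_def)

lemma vec_eq_2: "(x :: real ^ 2) = y \<longleftrightarrow> x $ 1 = y $ 1 \<and> x $ 2 = y $ 2"
  by (simp add: vec_eq_iff forall_2)

lemma continuous_on_vector_2 [continuous_intros]: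
  fixes f g :: "'a::topological_space \<Rightarrow> real"
  assumes "continuous_on S f" "continuous_on S g"
  shows "continuous_on S (\<lambda>x. vector [f x, g x] :: real ^ 2)"
proof -
  have "(\<lambda>x. vector [f x, g x] :: real ^ 2) = (\<lambda>x. f x *\<^sub>R axis 1 1 + g x *\<^sub>R axis 2 1)"
    by (auto simp: fun_eq_iff vec_eq_2 axis_def)
  moreover have "continuous_on S (\<lambda>x. f x *\<^sub>R axis 1 1 + g x *\<^sub>R axis 2 1 :: real ^ 2)"
    using assms by (intro continuous_intros)
  ultimately show ?thesis by (simp only:)
qed

lemma continuous_on_unit_vec [continuous_intros]:
  fixes f :: "'a::t2_space \<Rightarrow> real"
  assumes "continuous_on S f"
  shows "continuous_on S (\<lambda>x. unit_vec (f x))"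
  unfolding unit_vec_def by (intro continuous_intros assms)

lemma norm_unit_vec [simp]: "norm (unit_vec t) = 1"
  by (simp add: norm_vec_def L2_set_def UNIV_2)

lemma borel_measurable_unit_vec [measurable]: "unit_vec \<in> borel_measurable borel"
  by (intro borel_measurable_continuous_onI continuous_intros)

lemma has_vector_derivative_unit_vec:
  "(unit_vec has_vector_derivative unit_vec (t + pi / 2)) (at t within S)"
proof -
  have *: "unit_vec = (\<lambda>x. cos x *\<^sub>R axis 1 1 + sin x *\<^sub>R axis 2 1)"
    by (auto simp: fun_eq_iff vec_eq_2 axis_def)
  show ?thesis
    unfolding *
    by (rule derivative_eq_intros refl | simp add: cos_add sin_add)+
qed

text \<open>
  Moves two-dimensional integrals from \<open>real ^ 2\<close>, where the change of variables theorem lives, to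
  the product type, where Fubini does.
\<close>

lemma lborel_vec_2:
  "(lborel :: (real ^ 2) measure) = distr (lborel :: (real \<times> real) measure) borel (\<lambda>(a, b). vector [a, b])"
proof (rule lborel_eqI)
  fix l u :: "real ^ 2" assume lu: "\<And>b. b \<in> Basis \<Longrightarrow> l \<bullet> b \<le> u \<bullet> b"
  have m [measurable]: "(\<lambda>(a, b). vector [a, b] :: real ^ 2) \<in> borel_measurable borel"
    unfolding split_beta by (intro borel_measurable_continuous_onI continuous_intros)
  have "(\<lambda>(a, b). vector [a, b] :: real ^ 2) -` box l u = box (l $ 1, l $ 2) (u $ 1, u $ 2)"
    by (rule set_eqI) (auto simp add: split_beta mem_box_cart forall_2 mem_box Basis_prod_def ball_Un)
  moreover have "(\<Prod>b\<in>Basis. (u - l) \<bullet> b) = (u $ 1 - l $ 1) * (u $ 2 - l $ 2)"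
    by (simp add: Basis_vec_def UN_insert UNIV_2 axis_eq_axis inner_axis)
  ultimately show "emeasure (distr (lborel :: (real \<times> real) measure) borel (\<lambda>(a, b). vector [a, b])) (box l u)
      = ennreal (\<Prod>b\<in>Basis. (u - l) \<bullet> b)"
    using lu[of "axis 1 1"] lu[of "axis 2 1"]
    by (simp add: emeasure_distr emeasure_lborel_box_eq Basis_prod_def inner_axis)
qed simp

definition polar_domain :: "(real \<times> real) set" where
  "polar_domain = {0<..} \<times> {0..<2 * pi}"

lemma polar_domain_measurable [measurable]: "polar_domain \<in> sets borel"
  unfolding polar_domain_def borel_prod[symmetric] by measurable

lemma polar_map_measurable [measurable]:
  "(\<lambda>z. p + fst z *\<^sub>R unit_vec (snd z)) \<in> borel_measurable borel"
  by (intro borel_measurable_continuous_onI continuous_intros)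

lemma polar_map_bij_betw:
  "bij_betw (\<lambda>v::real^2. p + (v $ 1) *\<^sub>R unit_vec (v $ 2)) {v. 0 < v $ 1 \<and> 0 \<le> v $ 2 \<and> v $ 2 < 2 * pi} (- {p})"
proof (rule bij_betw_imageI)
  show "inj_on (\<lambda>v::real^2. p + (v $ 1) *\<^sub>R unit_vec (v $ 2)) {v. 0 < v $ 1 \<and> 0 \<le> v $ 2 \<and> v $ 2 < 2 * pi}"
  proof (rule inj_onI)
    fix v w :: "real ^ 2"
    assume "v \<in> {v. 0 < v $ 1 \<and> 0 \<le> v $ 2 \<and> v $ 2 < 2 * pi}" "w \<in> {v. 0 < v $ 1 \<and> 0 \<le> v $ 2 \<and> v $ 2 < 2 * pi}"
      and "p + v $ 1 *\<^sub>R unit_vec (v $ 2) = p + w $ 1 *\<^sub>R unit_vec (w $ 2)"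
    then have v: "0 < v $ 1" "0 \<le> v $ 2" "v $ 2 < 2 * pi"
      and w: "0 < w $ 1" "0 \<le> w $ 2" "w $ 2 < 2 * pi"
      and eq: "v $ 1 *\<^sub>R unit_vec (v $ 2) = w $ 1 *\<^sub>R unit_vec (w $ 2)" by auto
    from arg_cong[OF eq, of norm] v w have 1: "v $ 1 = w $ 1" by simp
    with eq v have "unit_vec (v $ 2) = unit_vec (w $ 2)" by simp
    then have "sin (v $ 2) = sin (w $ 2) \<and> cos (v $ 2) = cos (w $ 2)" by (simp add: vec_eq_2)
    then obtain n :: int where n: "v $ 2 = w $ 2 + 2 * pi * n" using sin_cos_eq_iff by auto
    with v w have "2 * pi * n < 2 * pi * 1" "2 * pi * (- 1) < 2 * pi * n" by linarith+
    then have "real_of_int n < 1" "- 1 < real_of_int n"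
      using pi_gt_zero by (auto simp only: mult_less_cancel_left_pos zero_less_mult_iff zero_less_numeral simp_thms)
    then have "n = 0" by linarith
    with n 1 show "v = w" by (simp add: vec_eq_2)
  qed
  show "(\<lambda>v::real^2. p + (v $ 1) *\<^sub>R unit_vec (v $ 2)) ` {v. 0 < v $ 1 \<and> 0 \<le> v $ 2 \<and> v $ 2 < 2 * pi} = - {p}"
  proof (intro equalityI subsetI)
    fix y assume "y \<in> (\<lambda>v::real^2. p + (v $ 1) *\<^sub>R unit_vec (v $ 2)) ` {v. 0 < v $ 1 \<and> 0 \<le> v $ 2 \<and> v $ 2 < 2 * pi}"
    then obtain v :: "real ^ 2" where v: "0 < v $ 1" "y = p + (v $ 1) *\<^sub>R unit_vec (v $ 2)" by auto
    then have "norm (y - p) \<noteq> 0" by simp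
    then show "y \<in> - {p}" by auto
  next
    fix y assume "y \<in> - {p}"
    then have y: "y \<noteq> p" by simp
    define r where "r = norm (y - p)"
    have r: "r > 0" using y by (simp add: r_def)
    have "r\<^sup>2 = ((y - p) $ 1)\<^sup>2 + ((y - p) $ 2)\<^sup>2"
      by (simp add: r_def norm_vec_def L2_set_def UNIV_2)
    then have "((y - p) $ 1 / r)\<^sup>2 + ((y - p) $ 2 / r)\<^sup>2 = r\<^sup>2 / r\<^sup>2"
      by (simp only: power_divide add_divide_distrib[symmetric])
    then have "((y - p) $ 1 / r)\<^sup>2 + ((y - p) $ 2 / r)\<^sup>2 = 1"
      using r by simp
    from sincos_total_2pi[OF this] obtain t where
      t: "0 \<le> t" "t < 2 * pi" "(y - p) $ 1 / r = cos t" "(y - p) $ 2 / r = sin t" by blast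
    show "y \<in> (\<lambda>v::real^2. p + (v $ 1) *\<^sub>R unit_vec (v $ 2)) ` {v. 0 < v $ 1 \<and> 0 \<le> v $ 2 \<and> v $ 2 < 2 * pi}"
      by (rule image_eqI[of _ _ "vector [r, t]"])
         (use t r in \<open>auto simp: vec_eq_2 field_simps\<close>)
  qed
qed

lemma polar_density_measurable [measurable]:
  "(\<lambda>z. indicator polar_domain z * fst z :: real) \<in> borel_measurable borel"
  by (intro borel_measurable_times borel_measurable_indicator polar_domain_measurable
      borel_measurable_continuous_onI continuous_intros)

text \<open>
  A measure is Lebesgue measure once it is right on boxes. For a box, the change of variables theorem
  applied to its preimage in the parameter domain gives the area as the integral of the Jacobian \<open>r\<close>.
  As an identity of measures, this gives integrability and values of integrals at the same time.
\<close>

lemma lborel_polar: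
  "(lborel :: (real ^ 2) measure) =
     distr (density lborel (\<lambda>z. ennreal (indicator polar_domain z * fst z))) borel
       (\<lambda>z. p + fst z *\<^sub>R unit_vec (snd z))"
proof (rule lborel_eqI)
  fix l u :: "real ^ 2" assume lu: "\<And>b. b \<in> Basis \<Longrightarrow> l \<bullet> b \<le> u \<bullet> b"
  let ?G = "\<lambda>v::real^2. p + (v $ 1) *\<^sub>R unit_vec (v $ 2)"
  \<comment> \<open>The angular derivative is \<open>v $ 1\<close> times the unit vector turned by a right angle, so the Jacobian is \<open>v $ 1\<close>.\<close>
  let ?G' = "\<lambda>v h::real^2. (h $ 1) *\<^sub>R unit_vec (v $ 2) + (v $ 1 * h $ 2) *\<^sub>R unit_vec (v $ 2 + pi / 2)"
  define D where "D = {v::real^2. 0 < v $ 1 \<and> 0 \<le> v $ 2 \<and> v $ 2 < 2 * pi}"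
  define S where "S = {v \<in> D. ?G v \<in> box l u}"
  have [measurable]: "?G \<in> borel_measurable borel"
    by (intro borel_measurable_continuous_onI continuous_intros)
  have [measurable]: "D \<in> sets borel" unfolding D_def by measurable
  have S [measurable]: "S \<in> sets borel" unfolding S_def by measurable
  have der: "(?G has_derivative ?G' v) (at v within S)" for v
  proof -
    have "((\<lambda>v. unit_vec (v $ 2)) has_derivative (\<lambda>h. h $ 2 *\<^sub>R unit_vec (v $ 2 + pi / 2))) (at v within S)"
      by (rule has_derivative_compose[where f = "\<lambda>v. v $ 2", OF bounded_linear_imp_has_derivative
            has_vector_derivative_unit_vec[unfolded has_vector_derivative_def], unfolded]) (rule bounded_linear_vec_nth)
    then show ?thesis
      by (auto intro!: derivative_eq_intros bounded_linear_imp_has_derivative bounded_linear_vec_nth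
               simp: algebra_simps)
  qed
  have det: "det (matrix (?G' v)) = v $ 1" for v
    by (simp add: det_2 matrix_def axis_def sin_add cos_add algebra_simps
                  power2_eq_square[symmetric] distrib_left[symmetric])
  have img: "?G ` S = box l u - {p}"
    using polar_map_bij_betw[of p] unfolding S_def D_def bij_betw_def by (auto 0 3)
  have inj: "inj_on ?G S"
    using polar_map_bij_betw[of p] unfolding bij_betw_def S_def D_def by (auto intro: inj_on_subset)
  have meas: "box l u - {p} \<in> lmeasurable" "measure lebesgue (box l u - {p}) = (\<Prod>b\<in>Basis. (u - l) \<bullet> b)"
    using lu by (auto intro!: fmeasurable.Diff simp: lmeasurable_box negligible_imp_measurable measure_Diff_null_set measure_lborel_box_eq)
  have "((\<lambda>v. \<bar>det (matrix (?G' v))\<bar>) has_integral (\<Prod>b\<in>Basis. (u - l) \<bullet> b)) S"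
    using has_measure_differentiable_image[of S ?G ?G' "\<Prod>b\<in>Basis. (u - l) \<bullet> b"] der inj meas S unfolding img by simp
  then have "((\<lambda>v. v $ 1) has_integral (\<Prod>b\<in>Basis. (u - l) \<bullet> b)) S"
    by (rule has_integral_eq[rotated]) (auto simp: det S_def D_def)
  then have "ennreal (\<Prod>b\<in>Basis. (u - l) \<bullet> b) = (\<integral>\<^sup>+v. ennreal (v $ 1) * indicator S v \<partial>lborel)"
    by (intro sym[OF nn_integral_has_integral_lebesgue']) (auto simp: S_def D_def)
  also have "\<dots> =
     (\<integral>\<^sup>+z. ennreal (fst z) * indicator S (vector [fst z, snd z] :: real ^ 2) \<partial>lborel)"
    by (subst lborel_vec_2, subst nn_integral_distr)
       (auto simp: split_beta intro!: borel_measurable_continuous_onI continuous_intros)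
  also have "\<dots> = emeasure (distr (density lborel (\<lambda>z. ennreal (indicator polar_domain z * fst z))) borel
       (\<lambda>z. p + fst z *\<^sub>R unit_vec (snd z))) (box l u)"
    using measurable_sets[OF polar_map_measurable, of "box l u" p]
    by (subst emeasure_distr, simp, simp, subst emeasure_density, use polar_density_measurable in simp, simp)
       (auto intro!: nn_integral_cong simp: S_def D_def polar_domain_def indicator_def)
  finally show "emeasure (distr (density lborel (\<lambda>z. ennreal (indicator polar_domain z * fst z))) borel
       (\<lambda>z. p + fst z *\<^sub>R unit_vec (snd z))) (box l u) = ennreal (\<Prod>b\<in>Basis. (u - l) \<bullet> b)" ..
qed simp

section \<open>Logarithmic integrals on the line\<close>

text \<open>
  Gauge integrals are where the fundamental theorem of calculus and the affine substitutions are applied;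
  this brings their values back to the Lebesgue integral.
\<close>

lemma has_bochner_integral_lborelI:
  fixes f :: "'a::euclidean_space \<Rightarrow> real"
  assumes [measurable]: "f \<in> borel_measurable borel" "A \<in> sets borel"
    and f: "f absolutely_integrable_on A" "(f has_integral I) A"
  shows "has_bochner_integral lborel (\<lambda>x. indicator A x *\<^sub>R f x) I"
proof -
  have "set_integrable lborel A f"
    using f(1) unfolding set_integrable_def by (subst (asm) integrable_completion) auto
  then show ?thesis
    using set_borel_integral_eq_integral[of A f] integral_unique[OF f(2)]
    by (simp add: has_bochner_integral_iff set_integrable_def set_lebesgue_integral_def)
qed

text \<open>
  Comes from \<open>ln u \<le> u - 1\<close> at \<open>u = 1 / sqrt t\<close>.
\<close>

lemma abs_x_ln_le_sqrt:
  fixes t :: real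
  assumes "0 \<le> t" "t \<le> 1"
  shows "\<bar>t * ln t\<bar> \<le> 2 * sqrt t"
proof (cases "t = 0")
  case False
  then have t: "t > 0" using assms by simp
  have "ln (1 / sqrt t) \<le> 1 / sqrt t - 1" using t by (intro ln_le_minus_one) simp
  then have "- ln t \<le> 2 / sqrt t"
    using t by (simp add: ln_div ln_sqrt)
  then have "t * (- ln t) \<le> t * (2 / sqrt t)" using t by (intro mult_left_mono) auto
  also have "t * (2 / sqrt t) = 2 * sqrt t" using t real_div_sqrt[of t] by (simp add: field_simps)
  finally have "- (t * ln t) \<le> 2 * sqrt t" by simp
  moreover have "t * ln t \<le> 0" using t assms by (intro mult_nonneg_nonpos) auto
  ultimately show ?thesis using t by simp
qed simp

lemma continuous_on_x_ln: "continuous_on {0..} (\<lambda>t::real. t * ln t)"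
proof (rule continuous_on_eq_continuous_within[THEN iffD2], safe)
  fix t :: real assume "0 \<le> t"
  show "continuous (at t within {0..}) (\<lambda>t. t * ln t)"
  proof (cases "t = 0")
    case False
    with \<open>0 \<le> t\<close> show ?thesis by (intro continuous_intros) auto
  next
    case True
    have "((\<lambda>t::real. t * ln t) \<longlongrightarrow> 0) (at 0 within {0..})"
    proof (rule Lim_null_comparison)
      show "\<forall>\<^sub>F t::real in at 0 within {0..}. norm (t * ln t) \<le> 2 * sqrt t"
        using abs_x_ln_le_sqrt by (auto simp: eventually_at intro!: exI[of _ 1])
      show "((\<lambda>t::real. 2 * sqrt t) \<longlongrightarrow> 0) (at 0 within {0..})"
        by (rule tendsto_eq_intros refl | simp)+
    qed
    then show ?thesis by (simp add: True continuous_within)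
  qed
qed

text \<open>
  The condition \<open>1 \<le> y\<close> covers the default value \<open>ln 0 = 0\<close>.
\<close>

lemma ln_mono':
  fixes x y :: real
  assumes "0 \<le> x" "x \<le> y" "1 \<le> y"
  shows "ln x \<le> ln y"
  using assms by (cases "x = 0") (auto intro: ln_mono)

text \<open>
  On \<open>[0, B]\<close> with \<open>B \<ge> 1\<close> the function \<open>ln B - ln t\<close> is nonnegative and has an antiderivative that is
  continuous up to \<open>0\<close>, so it is absolutely integrable; the rest is reflection.
\<close>

lemma set_integrable_ln_abs:
  fixes a b :: real
  shows "set_integrable lborel {a..b} (\<lambda>t. ln \<bar>t\<bar>)"
proof -
  define B where "B = max 1 (max \<bar>a\<bar> \<bar>b\<bar>)"
  have B: "1 \<le> B" "\<bar>a\<bar> \<le> B" "\<bar>b\<bar> \<le> B" by (auto simp: B_def)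
  have "((\<lambda>t. ln B - ln t) has_integral ((B * ln B - (B * ln B - B)) - (0 * ln B - (0 * ln 0 - 0)))) {0..B}"
  proof (rule fundamental_theorem_of_calculus_interior)
    show "continuous_on {0..B} (\<lambda>t. t * ln B - (t * ln t - t))"
      by (intro continuous_intros continuous_on_subset[OF continuous_on_x_ln]) auto
    show "((\<lambda>t. t * ln B - (t * ln t - t)) has_vector_derivative ln B - ln t) (at t)" if "t \<in> {0<..<B}" for t
      unfolding has_real_derivative_iff_has_vector_derivative[symmetric] using that
      by (auto intro!: derivative_eq_intros)
  qed (use B in auto)
  then have "(\<lambda>t. ln B - ln t) absolutely_integrable_on {0..B}"
    using B by (intro nonnegative_absolutely_integrable_1)
       (auto simp: has_integral_iff intro!: ln_mono' )
  moreover have "(\<lambda>t. ln B) absolutely_integrable_on {0..B}"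
    by (intro absolutely_integrable_continuous_real continuous_intros)
  ultimately have "(\<lambda>t. ln B - (ln B - ln t)) absolutely_integrable_on {0..B}"
    by (rule set_integral_diff(1)[rotated])
  then have "(\<lambda>t. ln \<bar>t\<bar>) absolutely_integrable_on {0..B}"
    by (rule absolutely_integrable_spike[where S = "{}"]) simp_all
  then have pos: "integrable lborel (\<lambda>t. indicator {0..B} t * ln \<bar>t\<bar>)"
    unfolding set_integrable_def by (subst (asm) integrable_completion) auto
  have neg: "integrable lborel (\<lambda>t. indicator {-B..0} t * ln \<bar>t\<bar>)"
    using lborel_integrable_real_affine[OF pos, of "-1" 0]
    by (rule Bochner_Integration.integrable_cong[THEN iffD1, rotated -1]) (auto simp: indicator_def)
  have "set_integrable lborel ({-B..0} \<union> {0..B}) (\<lambda>t. ln \<bar>t\<bar>)"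
    using pos neg by (intro set_integrable_Un) (simp_all add: set_integrable_def)
  then show ?thesis
    by (rule set_integrable_subset) (use B in auto)
qed

lemma set_integrable_ln_abs_shift:
  fixes a b c :: real
  shows "set_integrable lborel {a..b} (\<lambda>t. ln \<bar>t + c\<bar>)"
proof -
  have "integrable lborel (\<lambda>t. indicator {a+c..b+c} t * ln \<bar>t\<bar>)"
    using set_integrable_ln_abs[of "a+c" "b+c"] by (simp add: set_integrable_def)
  from lborel_integrable_real_affine[OF this, of 1 c] show ?thesis
    unfolding set_integrable_def
    by (rule Bochner_Integration.integrable_cong[THEN iffD1, rotated -1]) (auto simp: indicator_def add_ac)
qed

text \<open>
  The singularities at \<open>r = \<plusminus>c\<close> are those of \<open>ln \<bar>r - c\<bar>\<close> and \<open>ln \<bar>r + c\<bar>\<close>.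
\<close>

lemma set_integrable_ln_abs_diff_squares:
  fixes c :: real
  shows "set_integrable lborel {a..b} (\<lambda>r. ln \<bar>r\<^sup>2 - c\<^sup>2\<bar>)"
proof -
  have *: "set_integrable lborel {a..b} (\<lambda>r. ln \<bar>r + c\<bar> + ln \<bar>r + (- c)\<bar>)"
    by (intro set_integral_add set_integrable_ln_abs_shift)
  have "AE r in lborel. r \<noteq> c" "AE r in lborel. r \<noteq> - c"
    by (simp_all add: AE_lborel_singleton)
  then have "AE r in lborel. r \<in> {a..b} \<longrightarrow> ln \<bar>r + c\<bar> + ln \<bar>r + (- c)\<bar> = ln \<bar>r\<^sup>2 - c\<^sup>2\<bar>"
  proof eventually_elim
    case (elim r)
    then have "r + c \<noteq> 0" "r + (- c) \<noteq> 0" by auto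
    moreover have "r\<^sup>2 - c\<^sup>2 = (r + c) * (r + (- c))" by (simp add: power2_eq_square algebra_simps)
    ultimately show ?case by (simp only: abs_mult ln_mult abs_eq_0 simp_thms if_True)
  qed
  with * show ?thesis
    by (subst set_integrable_cong_AE[symmetric]) auto
qed

lemma periodic_has_integral:
  fixes f :: "real \<Rightarrow> real"
  assumes f: "(f has_integral I) {0..T}" and T: "T > 0" and per: "\<And>x. f (x + T) = f x"
  shows "(f has_integral I) {a..a + T}"
proof -
  have per_nat: "f (x + real n * T) = f x" for x n
  proof (induction n)
    case (Suc n)
    then show ?case using per[of "x + real n * T"] by (simp add: algebra_simps)
  qed simp
  have per_int: "f (x + of_int k * T) = f x" for x k
  proof (cases k rule: int_cases2)
    case (nonneg n)
    then show ?thesis using per_nat[of x n] by simp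
  next
    case (nonpos n)
    then show ?thesis using per_nat[of "x + of_int k * T" n] by simp
  qed
  \<comment> \<open>The interval is shifted so that it starts in \<open>[0, T]\<close>; the part beyond \<open>T\<close> is then moved to the front.\<close>
  define k where "k = \<lfloor>a / T\<rfloor>"
  define b where "b = a - of_int k * T"
  have "of_int k \<le> a / T" "a / T < of_int k + 1" unfolding k_def by linarith+
  then have b: "0 \<le> b" "b \<le> T" using T by (auto simp: b_def field_simps)
  have i: "f integrable_on {0..b}" "f integrable_on {b..T}"
    using f b by (auto simp: has_integral_iff intro: integrable_on_subinterval)
  have "integral {0..b} f + integral {b..T} f = I"
    using f b by (subst Henstock_Kurzweil_Integration.integral_combine) (auto simp: has_integral_iff)
  moreover have "(f has_integral integral {0..b} f) {T..b + T}"
    using has_integral_shift_real_ivl[OF integrable_integral[OF i(1)], of "- T"] per[of "_ - T"]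
    by (simp add: algebra_simps)
  ultimately have "(f has_integral I) {b..b + T}"
    using has_integral_combine[of b T "b + T" f, OF _ _ integrable_integral[OF i(2)]] b
    by (fastforce simp: add.commute)
  from has_integral_shift_real_ivl[OF this, of "- (of_int k * T)"] show ?thesis
    using per_int[of "_ - of_int k * T" k] by (simp add: b_def algebra_simps)
qed

text \<open>
  With \<open>v = u / 2\<close>: \<open>sin u = tan v (1 + cos u) \<ge> tan v \<ge> v\<close>.
\<close>

lemma sin_ge_half:
  assumes "0 \<le> u" "u \<le> pi / 2"
  shows "u / 2 \<le> sin u"
proof -
  have u: "0 \<le> u / 2" "u / 2 < pi / 2" using assms pi_gt_zero by linarith+
  have c: "cos (u / 2) \<noteq> 0" using assms pi_gt_zero by (intro less_imp_neq[symmetric] cos_gt_zero_pi) linarith+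
  have "\<bar>u / 2\<bar> < pi / 2" using u by linarith
  from abs_tan_ge[OF this] have "u / 2 \<le> \<bar>tan (u / 2)\<bar>" by linarith
  also have "\<bar>tan (u / 2)\<bar> = tan (u / 2)"
    using u by (auto intro!: abs_of_nonneg tan_pos_pi2_le)
  also have "\<dots> \<le> tan (u / 2) * (1 + cos u)"
    using u assms cos_ge_zero[of u] by (simp add: distrib_left tan_pos_pi2_le)
  also have "1 + cos u = 2 * (cos (u / 2))\<^sup>2" using cos_double_cos[of "u / 2"] by simp
  also have "tan (u / 2) * (2 * (cos (u / 2))\<^sup>2) = sin u"
    using c sin_double[of "u / 2"] by (simp add: tan_def power2_eq_square)
  finally show ?thesis .
qed

text \<open>
  A multiple of \<open>u (\<pi> - u)\<close> bounds the sine from below on \<open>[0, \<pi>]\<close>, so \<open>\<bar>ln sin\<bar>\<close> is dominated by logarithms of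
  linear functions, whose integrability is known.
\<close>

lemma neg_ln_sin_le:
  assumes "0 < u" "u < pi"
  shows "- ln (sin u) \<le> ln (2 * pi) - ln u - ln (pi - u)"
proof -
  have "u * (pi - u) / (2 * pi) \<le> sin u"
  proof (cases "u \<le> pi / 2")
    case True
    have "u * (pi - u) / (2 * pi) \<le> u * pi / (2 * pi)"
      using assms by (intro divide_right_mono mult_left_mono) auto
    also have "\<dots> = u / 2" by simp
    finally show ?thesis using sin_ge_half[of u] True assms by linarith
  next
    case False
    have "u * (pi - u) / (2 * pi) \<le> pi * (pi - u) / (2 * pi)"
      using assms by (intro divide_right_mono mult_right_mono) auto
    also have "\<dots> = (pi - u) / 2" by simp
    finally show ?thesis using sin_ge_half[of "pi - u"] False assms sin_pi_minus[of u] by linarith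
  qed
  then have "ln (u * (pi - u) / (2 * pi)) \<le> ln (sin u)"
    using assms by (intro ln_mono) auto
  then show ?thesis using assms by (simp add: ln_div ln_mult)
qed

lemma neg_ln_sin_integrable: "(\<lambda>u. - ln \<bar>sin u\<bar>) absolutely_integrable_on {0..pi}"
proof -
  have "set_integrable lborel {0..pi} (\<lambda>u. ln (2 * pi) + \<bar>ln \<bar>u + 0\<bar>\<bar> + \<bar>ln \<bar>u + (- pi)\<bar>\<bar>)"
    by (intro set_integral_add set_integrable_abs set_integrable_ln_abs_shift) (simp add: set_integrable_def)
  then have "set_integrable lborel {0..pi} (\<lambda>u. - ln \<bar>sin u\<bar>)"
  proof (rule set_integrable_bound)
    show "AE u in lborel. u \<in> {0..pi} \<longrightarrow>
        norm (- ln \<bar>sin u\<bar>) \<le> norm (ln (2 * pi) + \<bar>ln \<bar>u + 0\<bar>\<bar> + \<bar>ln \<bar>u + (- pi)\<bar>\<bar>)"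
    proof (intro AE_I2 impI)
      fix u :: real assume u: "u \<in> {0..pi}"
      have l: "ln (2 * pi) \<ge> 0" using pi_ge_two by simp
      show "norm (- ln \<bar>sin u\<bar>) \<le> norm (ln (2 * pi) + \<bar>ln \<bar>u + 0\<bar>\<bar> + \<bar>ln \<bar>u + (- pi)\<bar>\<bar>)"
      proof (cases "u = 0 \<or> u = pi")
        case False
        then have u: "0 < u" "u < pi" using u by auto
        moreover have "sin u > 0" using u by (simp add: sin_gt_zero)
        moreover have "ln (sin u) \<le> 0" using \<open>sin u > 0\<close> by simp
        ultimately have "norm (- ln \<bar>sin u\<bar>) \<le> ln (2 * pi) - ln u - ln (pi - u)"
          using neg_ln_sin_le[OF u] by simp
        also have "\<dots> \<le> ln (2 * pi) + \<bar>ln u\<bar> + \<bar>ln (pi - u)\<bar>" by linarith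
        also have "\<dots> = norm (ln (2 * pi) + \<bar>ln \<bar>u + 0\<bar>\<bar> + \<bar>ln \<bar>u + (- pi)\<bar>\<bar>)"
          using u l by simp
        finally show ?thesis .
      qed (use l in auto)
    qed
  qed (auto simp: set_borel_measurable_def)
  then show ?thesis unfolding set_integrable_def by (subst integrable_completion) auto
qed

text \<open>
  Euler's argument. Let \<open>I\<close> be the integral of \<open>- ln \<bar>sin\<bar>\<close> over a period. Doubling the angle and shifting it by
  \<open>\<pi> / 2\<close> both leave \<open>I\<close> unchanged, so integrating \<open>ln \<bar>sin 2u\<bar> = ln 2 + ln \<bar>sin u\<bar> + ln \<bar>cos u\<bar>\<close> gives
  \<open>- I = \<pi> ln 2 - 2 I\<close>. With the minus sign the integrand is nonnegative, which makes it absolutely integrable.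
\<close>

lemma neg_ln_sin_has_integral: "((\<lambda>u. - ln \<bar>sin u\<bar>) has_integral pi * ln 2) {a..a + pi}"
proof -
  define k where "k = (\<lambda>u. - ln \<bar>sin u\<bar> :: real)"
  define I where "I = integral {0..pi} k"
  have I: "(k has_integral I) {0..pi}"
    unfolding I_def k_def
    by (intro integrable_integral set_lebesgue_integral_eq_integral neg_ln_sin_integrable)
  have per: "(k has_integral I) {a..a + pi}" for a
    by (rule periodic_has_integral[OF I]) (auto simp: k_def)
  have "((\<lambda>u. k (2 * u)) has_integral I) {0..pi}"
  proof -
    have "(k has_integral (I + I)) {0..2 * pi}"
      using has_integral_combine[of 0 pi "2 * pi" k I I] per[of 0] per[of pi] by simp
    from has_integral_affinity'[of k _ 0 "2 * pi" 2 0, unfolded cbox_interval, OF this] show ?thesis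
      by simp
  qed
  moreover have "((\<lambda>u. k (u + pi / 2)) has_integral I) {0..pi}"
    using has_integral_shift_real_ivl[OF per[of "pi / 2"], of "pi / 2"] by simp
  ultimately have "((\<lambda>u. k (2 * u) - k u - k (u + pi / 2)) has_integral (I - I - I)) {0..pi}"
    using I by (intro has_integral_diff)
  moreover have "((\<lambda>u. k (2 * u) - k u - k (u + pi / 2)) has_integral (- (pi * ln 2))) {0..pi}"
  proof (rule has_integral_spike_finite[where S = "{0, pi / 2, pi}"])
    show "((\<lambda>u. - ln 2) has_integral (- (pi * ln 2))) {0..pi}"
      using has_integral_const_real[of "- ln 2 :: real" 0 pi] by simp
    fix u assume u: "u \<in> {0..pi} - {0, pi / 2, pi}"
    then have s: "sin u > 0" by (auto intro!: sin_gt_zero)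
    have c: "cos u \<noteq> 0"
    proof
      assume "cos u = 0"
      then have "cos u = cos (pi / 2)" by simp
      then show False using u cos_inj_pi[of u "pi / 2"] by auto
    qed
    have "k (2 * u) = - ln (2 * sin u * \<bar>cos u\<bar>)"
      using s by (simp add: k_def sin_double abs_mult)
    also have "\<dots> = - ln 2 - ln (sin u) - ln \<bar>cos u\<bar>"
      using s c by (simp add: ln_mult)
    finally show "k (2 * u) - k u - k (u + pi / 2) = - ln 2"
      using s by (simp add: k_def sin_add)
  qed auto
  ultimately have "I - I - I = - (pi * ln 2)" by (rule has_integral_unique)
  then have "I = pi * ln 2" by simp
  then show ?thesis using per[of a] by (simp add: k_def)
qed

section \<open>The logarithmic kernel averaged over a circle\<close>

lemma circle_param_measurable:
  "(\<lambda>s. vector [R * cos (s / R), R * sin (s / R)] :: real ^ 2) \<in> borel_measurable (restrict_space lborel A)"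
  by (intro measurable_restrict_space1)
     (auto intro!: borel_measurable_continuous_onI continuous_intros simp: divide_inverse)

lemma sets_circle_arc_length [simp, measurable_cong]: "sets (circle_arc_length R) = sets borel"
  by (simp add: circle_arc_length_def)

lemma space_circle_arc_length [simp]: "space (circle_arc_length R) = UNIV"
  by (simp add: circle_arc_length_def)

lemma finite_measure_circle_arc_length: "finite_measure (circle_arc_length R)"
proof (rule finite_measureI)
  have "emeasure (circle_arc_length R) UNIV = emeasure lborel {0..<2 * pi * R}"
    unfolding circle_arc_length_def
    by (subst emeasure_distr[OF circle_param_measurable]) (simp_all add: space_restrict_space emeasure_restrict_space)
  then show "emeasure (circle_arc_length R) (space (circle_arc_length R)) \<noteq> \<infinity>"
    by (cases "0 \<le> 2 * pi * R") auto
qed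

lemma circle_param_eq: "vector [R * cos (s / R), R * sin (s / R)] = R *\<^sub>R unit_vec (s / R)"
  by (simp add: vec_eq_2)

lemma integrable_circle_arc_length:
  fixes f :: "real ^ 2 \<Rightarrow> real"
  assumes "f \<in> borel_measurable borel"
  shows "integrable (circle_arc_length R) f \<longleftrightarrow>
    set_integrable lborel {0..<2 * pi * R} (\<lambda>s. f (R *\<^sub>R unit_vec (s / R)))"
  unfolding circle_arc_length_def
  by (subst integrable_distr_eq[OF circle_param_measurable assms], subst integrable_restrict_space)
     (simp_all add: circle_param_eq set_integrable_def)

lemma integral_circle_arc_length:
  fixes f :: "real ^ 2 \<Rightarrow> real"
  assumes "f \<in> borel_measurable borel"
  shows "integral\<^sup>L (circle_arc_length R) f = (LBINT s:{0..<2 * pi * R}. f (R *\<^sub>R unit_vec (s / R)))"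
  unfolding circle_arc_length_def
  by (subst integral_distr[OF circle_param_measurable assms], subst integral_restrict_space)
     (simp_all add: circle_param_eq set_lebesgue_integral_def)

lemma AE_circle_arc_length:
  assumes "R > 0"
  shows "AE p in circle_arc_length R. p \<in> sphere 0 R"
  unfolding circle_arc_length_def using assms
  by (subst AE_distr_iff[OF circle_param_measurable]) (auto simp: circle_param_eq)

lemma neg_ln_sin_half_has_integral:
  assumes R: "R > 0"
  shows "((\<lambda>s. - ln \<bar>sin ((s / R + c) / 2)\<bar>) has_integral 2 * pi * R * ln 2) {0..2 * pi * R}"
proof -
  have "((\<lambda>u. - ln \<bar>sin u\<bar>) has_integral pi * ln 2) (cbox (c / 2) (c / 2 + pi))"
    using neg_ln_sin_has_integral[of "c / 2"] by simp
  from has_integral_affinity'[OF this, of "1 / (2 * R)" "c / 2"] R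
  have "((\<lambda>s. - ln \<bar>sin ((1 / (2 * R)) *\<^sub>R s + c / 2)\<bar>) has_integral ((pi * ln 2) /\<^sub>R (1 / (2 * R)) ^ DIM(real)))
    (cbox ((c / 2 - c / 2) /\<^sub>R (1 / (2 * R))) ((c / 2 + pi - c / 2) /\<^sub>R (1 / (2 * R))))" by simp
  moreover have "(1 / (2 * R)) *\<^sub>R s + c / 2 = (s / R + c) / 2" for s
    by (simp add: add_divide_distrib)
  moreover have "(pi * ln 2) /\<^sub>R (1 / (2 * R)) ^ DIM(real) = 2 * pi * R * ln 2"
    "(c / 2 - c / 2) /\<^sub>R (1 / (2 * R)) = 0" "(c / 2 + pi - c / 2) /\<^sub>R (1 / (2 * R)) = 2 * pi * R"
    by simp_all
  ultimately show ?thesis by (simp only: cbox_interval)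
qed

lemma vec_polar_form:
  fixes z :: "real ^ 2"
  obtains t where "z = norm z *\<^sub>R unit_vec t"
proof (cases "z = 0")
  case False
  then obtain v :: "real ^ 2" where v: "0 < v $ 1" "z = v $ 1 *\<^sub>R unit_vec (v $ 2)"
    using polar_map_bij_betw[of 0] unfolding bij_betw_def by (auto simp: set_eq_iff image_iff)
  then show ?thesis using that[of "v $ 2"] by simp
qed (use that in auto)

lemma inner_2: "(x :: real ^ 2) \<bullet> y = x $ 1 * y $ 1 + x $ 2 * y $ 2"
  by (simp add: inner_vec_def UNIV_2)

lemma norm_power2_2: "(norm (x :: real ^ 2))\<^sup>2 = (x $ 1)\<^sup>2 + (x $ 2)\<^sup>2"
  unfolding power2_norm_eq_inner inner_2 by (simp add: power2_eq_square)

text \<open>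
  The quadratic terms in \<open>p = R e(t)\<close> cancel and leave \<open>2 R d (c - cos (t - b))\<close>, where \<open>d = \<bar>x - y\<bar>\<close>, \<open>b\<close> is the
  direction of \<open>y - x\<close> and \<open>c = (\<bar>y\<bar>\<^sup>2 - \<bar>x\<bar>\<^sup>2) / (2 R d)\<close>. Since \<open>\<bar>y\<bar>\<^sup>2 - \<bar>x\<bar>\<^sup>2 = (y - x) \<bullet> (y + x)\<close>,
  Cauchy-Schwarz yields \<open>\<bar>c\<bar> \<le> 1\<close>, so \<open>c\<close> is a cosine and the difference of two cosines factors.
\<close>

lemma log_kernel_factor:
  fixes x y :: "real ^ 2"
  assumes R: "R > 0" and x: "norm x \<le> R" and y: "norm y \<le> R" and ne: "x \<noteq> y"
  obtains a b where "\<And>t. (norm (y - R *\<^sub>R unit_vec t))\<^sup>2 - (norm (x - R *\<^sub>R unit_vec t))\<^sup>2 =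
    4 * R * norm (x - y) * sin ((t + a) / 2) * sin ((t + b) / 2)"
proof -
  define d where "d = norm (y - x)"
  have d: "d > 0" using ne by (simp add: d_def)
  obtain b where b: "y - x = d *\<^sub>R unit_vec b" using vec_polar_form[of "y - x"] by (auto simp: d_def)
  define c where "c = ((norm y)\<^sup>2 - (norm x)\<^sup>2) / (2 * R * d)"
  have "\<bar>(norm y)\<^sup>2 - (norm x)\<^sup>2\<bar> = \<bar>(y - x) \<bullet> (y + x)\<bar>"
    unfolding norm_power2_2 inner_2 by (simp add: power2_eq_square algebra_simps)
  also have "\<dots> \<le> d * norm (y + x)" unfolding d_def by (rule Cauchy_Schwarz_ineq2)
  also have "\<dots> \<le> d * (2 * R)"
    using d x y norm_triangle_ineq[of y x] by (intro mult_left_mono) auto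
  finally have "\<bar>c\<bar> \<le> 1" using R d by (simp add: c_def abs_mult field_simps)
  then have c: "cos (arccos c) = c" by (simp add: cos_arccos_abs)
  have "(norm (y - R *\<^sub>R unit_vec t))\<^sup>2 - (norm (x - R *\<^sub>R unit_vec t))\<^sup>2 =
    4 * R * norm (x - y) * sin ((t + (arccos c - b)) / 2) * sin ((t + (- b - arccos c)) / 2)" for t
  proof -
    have "(norm (y - R *\<^sub>R unit_vec t))\<^sup>2 - (norm (x - R *\<^sub>R unit_vec t))\<^sup>2 =
        (norm y)\<^sup>2 - (norm x)\<^sup>2 - 2 * R * ((y - x) \<bullet> unit_vec t)"
      unfolding norm_power2_2 inner_2 by (simp add: power2_eq_square algebra_simps)
    also have "(y - x) \<bullet> unit_vec t = d * cos (t - b)"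
      unfolding b by (simp add: inner_2 cos_diff algebra_simps)
    also have "(norm y)\<^sup>2 - (norm x)\<^sup>2 = 2 * R * d * cos (arccos c)"
      unfolding c using R d by (simp add: c_def)
    also have "2 * R * d * cos (arccos c) - 2 * R * (d * cos (t - b)) =
       2 * R * d * (cos (arccos c) - cos (t - b))" by (simp add: algebra_simps)
    also have "cos (arccos c) - cos (t - b) =
        2 * sin ((t + (arccos c - b)) / 2) * sin ((t + (- b - arccos c)) / 2)"
      by (subst cos_diff_cos) (simp add: algebra_simps)
    finally show ?thesis by (simp add: d_def norm_minus_commute)
  qed
  then show ?thesis by (rule that)
qed

lemma countable_sin_half_zeros: "countable {s::real. sin ((s / R + c) / 2) = 0}" if "R \<noteq> 0"
proof -
  have "{s::real. sin ((s / R + c) / 2) = 0} \<subseteq> range (\<lambda>i::int. (2 * of_int i * pi - c) * R)"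
  proof
    fix s assume "s \<in> {s::real. sin ((s / R + c) / 2) = 0}"
    then obtain i :: int where "(s / R + c) / 2 = of_int i * pi" by (auto simp: sin_zero_iff_int2)
    then have "s / R = 2 * of_int i * pi - c" by simp
    then have "s = (2 * of_int i * pi - c) * R" using that by (simp add: divide_eq_eq)
    then show "s \<in> range (\<lambda>i::int. (2 * of_int i * pi - c) * R)" by blast
  qed
  then show ?thesis by (rule countable_subset) auto
qed

text \<open>
  The logarithm of the product is \<open>ln (4 R d)\<close> plus two terms \<open>ln \<bar>sin\<bar>\<close>, each of mean \<open>- ln 2\<close>, outside the countable set
  where a factor vanishes. The angles \<open>a\<close> and \<open>b\<close> drop out because only full periods are integrated.
\<close>

lemma log_kernel_integral:
  fixes x y :: "real ^ 2"
  assumes R: "R > 0" and x: "norm x \<le> R" and y: "norm y \<le> R" and ne: "x \<noteq> y"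
  shows "has_bochner_integral (circle_arc_length R) (\<lambda>p. ln \<bar>(norm (y - p))\<^sup>2 - (norm (x - p))\<^sup>2\<bar>)
    (2 * pi * R * ln (R * norm (x - y)))"
proof -
  define F where "F = (\<lambda>p. ln \<bar>(norm (y - p))\<^sup>2 - (norm (x - p))\<^sup>2\<bar>)"
  define G where "G = (\<lambda>s. F (R *\<^sub>R unit_vec (s / R)))"
  define k where "k = (\<lambda>c s. - ln \<bar>sin ((s / R + c) / 2)\<bar>)"
  define d where "d = norm (x - y)"
  have d: "d > 0" using ne by (simp add: d_def)
  have [measurable]: "F \<in> borel_measurable borel" unfolding F_def by measurable
  have [measurable]: "G \<in> borel_measurable borel" unfolding G_def by measurable
  obtain a b where ab:
    "\<And>t. (norm (y - R *\<^sub>R unit_vec t))\<^sup>2 - (norm (x - R *\<^sub>R unit_vec t))\<^sup>2 =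
    4 * R * d * sin ((t + a) / 2) * sin ((t + b) / 2)"
    using log_kernel_factor[OF R x y ne, folded d_def] by blast
  define N where "N = {s::real. sin ((s / R + a) / 2) = 0} \<union> {s. sin ((s / R + b) / 2) = 0}"
  have N: "negligible N" unfolding N_def negligible_iff_null_sets using R
    by (intro null_sets_completionI countable_imp_null_set_lborel countable_Un countable_sin_half_zeros) auto
  have k: "(k c has_integral 2 * pi * R * ln 2) {0..2 * pi * R}" for c
    unfolding k_def using neg_ln_sin_half_has_integral[OF R] .
  have k': "k c absolutely_integrable_on {0..2 * pi * R}" for c

    using k[of c] by (intro nonnegative_absolutely_integrable_1)
      (simp_all add: has_integral_iff, simp add: k_def ln_mono'[of _ 1, simplified])
  have GK: "G s = ln (4 * R * d) - k a s - k b s" if "s \<in> {0..2 * pi * R} - N" for s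
    using that R d by (simp add: G_def F_def ab N_def abs_mult ln_mult k_def)
  have "(\<lambda>s. ln (4 * R * d) - k a s - k b s) absolutely_integrable_on {0..2 * pi * R}"
    by (intro set_integral_diff k' absolutely_integrable_continuous_real continuous_intros)
  from absolutely_integrable_spike[OF this N GK]
  have 1: "G absolutely_integrable_on {0..2 * pi * R}" .
  have "((\<lambda>s. ln (4 * R * d) - k a s - k b s) has_integral
      (2 * pi * R * ln (4 * R * d) - 2 * pi * R * ln 2 - 2 * pi * R * ln 2)) {0..2 * pi * R}"
    using has_integral_const_real[of "ln (4 * R * d)" 0 "2 * pi * R"] R
    by (intro has_integral_diff k) simp
  also have "2 * pi * R * ln (4 * R * d) - 2 * pi * R * ln 2 - 2 * pi * R * ln 2 = 2 * pi * R * ln (R * d)"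
  proof -
    have "4 * R * d = 2 * (2 * (R * d))" by simp
    then have "ln (4 * R * d) = ln 2 + (ln 2 + ln (R * d))"
      using R d by (simp only: ln_mult zero_less_mult_iff zero_less_numeral mult_eq_0_iff) simp
    then show ?thesis by (simp add: algebra_simps)
  qed
  finally have 2: "(G has_integral (2 * pi * R * ln (R * d))) {0..2 * pi * R}"
    by (rule has_integral_spike[OF N GK, rotated])
  have "G absolutely_integrable_on {0..<2 * pi * R}"
    by (rule set_integrable_subset[OF 1]) auto
  moreover have "(G has_integral (2 * pi * R * ln (R * d))) {0..<2 * pi * R}"
    by (rule has_integral_spike_set_eq[THEN iffD1, OF _ _ 2]) (auto intro: negligible_subset[of "{2 * pi * R}"])
  ultimately have "has_bochner_integral lborel (\<lambda>s. indicator {0..<2 * pi * R} s *\<^sub>R G s) (2 * pi * R * ln (R * d))"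
    by (intro has_bochner_integral_lborelI) auto
  then show ?thesis
    using integrable_circle_arc_length[of F R] integral_circle_arc_length[of F R]
    by (simp add: has_bochner_integral_iff G_def set_integrable_def set_lebesgue_integral_def F_def d_def)
qed

section \<open>Plane integrals with a radial weight\<close>

lemma measurable_density_polar:
  "(\<lambda>z. p + fst z *\<^sub>R unit_vec (snd z)) \<in> borel_measurable (density lborel w)"
  using polar_map_measurable by simp

lemma polar_integrable_iff:
  fixes u :: "real ^ 2 \<Rightarrow> real"
  assumes [measurable]: "u \<in> borel_measurable borel"
  shows "integrable lborel u \<longleftrightarrow>
    integrable (lborel \<Otimes>\<^sub>M lborel) (\<lambda>(r, t). indicator polar_domain (r, t) * r * u (p + r *\<^sub>R unit_vec t))"
proof -
  have m: "(\<lambda>z. u (p + fst z *\<^sub>R unit_vec (snd z))) \<in> borel_measurable lborel"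
    using measurable_compose[OF polar_map_measurable assms] by simp
  have nn: "AE z in lborel. 0 \<le> (indicator polar_domain z * fst z :: real)"
    by (auto simp: polar_domain_def indicator_def)
  show ?thesis
    unfolding lborel_polar[of p] integrable_distr_eq[OF measurable_density_polar assms]
    by (subst integrable_density[OF m _ nn]) (simp_all add: lborel_prod case_prod_beta')
qed

lemma polar_integral_eq:
  fixes u :: "real ^ 2 \<Rightarrow> real"
  assumes [measurable]: "u \<in> borel_measurable borel"
  shows "integral\<^sup>L lborel u =
    integral\<^sup>L (lborel \<Otimes>\<^sub>M lborel) (\<lambda>(r, t). indicator polar_domain (r, t) * r * u (p + r *\<^sub>R unit_vec t))"
proof -
  have m: "(\<lambda>z. u (p + fst z *\<^sub>R unit_vec (snd z))) \<in> borel_measurable lborel"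
    using measurable_compose[OF polar_map_measurable assms] by simp
  have nn: "AE z in lborel. 0 \<le> (indicator polar_domain z * fst z :: real)"
    by (auto simp: polar_domain_def indicator_def)
  show ?thesis
    unfolding lborel_polar[of p] integral_distr[OF measurable_density_polar assms]
    by (subst integral_density[OF m _ nn]) (simp_all add: lborel_prod case_prod_beta')
qed

lemma circular_mean_eq:
  assumes [measurable]: "g \<in> borel_measurable borel"
  shows "circular_mean g p r = 1 / (2 * pi) * (LBINT t:{0..<2 * pi}. g (p + r *\<^sub>R unit_vec t))"
  unfolding circular_mean_def by (subst integral_circle_arc_length) simp_all

lemma bounded_of_compact_support:
  fixes u :: "'a::euclidean_space \<Rightarrow> real"
  assumes u: "continuous_on UNIV u" and supp: "\<And>y. norm y > R \<Longrightarrow> u y = 0"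
  obtains C where "\<And>y. \<bar>u y\<bar> \<le> C"
proof -
  have "compact (u ` cball 0 R)"
    by (intro compact_continuous_image continuous_on_subset[OF u]) auto
  then obtain C where C: "\<And>y. y \<in> cball 0 R \<Longrightarrow> norm (u y) \<le> C"
    by (metis compact_imp_bounded bounded_iff imageI)
  have "\<bar>u y\<bar> \<le> max C 0" for y
    using C[of y] supp[of y] by (cases "y \<in> cball 0 R") auto
  then show ?thesis using that by blast
qed

text \<open>
  Polar coordinates about \<open>p\<close>: integrating the angle first turns \<open>g\<close> into its circular mean. The
  support condition makes the integrand vanish beyond radius \<open>B\<close>, so local integrability of the weight is
  enough.
\<close>

lemma radial_weight_integral:
  fixes g :: "real ^ 2 \<Rightarrow> real" and h :: "real \<Rightarrow> real"
  assumes g: "continuous_on UNIV g" and [measurable]: "h \<in> borel_measurable borel"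
    and h: "set_integrable lborel {0..B} h" and B: "0 \<le> B"
    and supp: "\<And>y. norm (y - p) > B \<Longrightarrow> g y = 0"
  shows "integrable lborel (\<lambda>y. g y * h (norm (y - p)))" (is ?A)
    and "set_integrable lborel {0..B} (\<lambda>r. r * circular_mean g p r * h r)" (is ?B)
    and "(LBINT r:{0..B}. r * circular_mean g p r * h r) =
           1 / (2 * pi) * integral\<^sup>L lborel (\<lambda>y. g y * h (norm (y - p)))" (is ?C)
proof -
  have [measurable]: "g \<in> borel_measurable borel" using g by (rule borel_measurable_continuous_onI)
  have far: "g y = 0" if "norm y > B + norm p" for y
    using that norm_triangle_sub[of y p] by (intro supp) linarith
  obtain C where C: "\<And>y. \<bar>g y\<bar> \<le> C" using bounded_of_compact_support[OF g far] by blast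
  have C0: "0 \<le> C" using C[of 0] by linarith
  define F where "F = (\<lambda>r t. indicator polar_domain (r, t) * r * (g (p + r *\<^sub>R unit_vec t) * h r))"
  have F: "F r t = indicator {0<..B} r * (indicator {0..<2 * pi} t * (r * h r * g (p + r *\<^sub>R unit_vec t)))" for r t
    using supp[of "p + r *\<^sub>R unit_vec t"] by (auto simp: F_def polar_domain_def indicator_def)
  have [measurable]: "case_prod F \<in> borel_measurable (lborel \<Otimes>\<^sub>M lborel)"
    unfolding F by measurable
  have gt: "set_integrable lborel {0..<2 * pi} (\<lambda>t. g (p + r *\<^sub>R unit_vec t))" for r
    unfolding set_integrable_def
    by (rule integrableI_bounded_set[where A = "{0..<2 * pi}" and B = C])
       (use C in \<open>auto simp: indicator_def\<close>)
  have Ft: "integrable lborel (F r)" for r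
    by (rule Bochner_Integration.integrable_cong[THEN iffD1, OF refl _ integrable_mult_right[OF gt[of r, unfolded set_integrable_def],
          of "indicator {0<..B} r * (r * h r)"]]) (simp add: F)
  have F_int: "integral\<^sup>L lborel (F r) = indicator {0<..B} r * (2 * pi * (r * circular_mean g p r * h r))" for r
  proof -
    have "integral\<^sup>L lborel (F r) = (indicator {0<..B} r * (r * h r)) * (LBINT t:{0..<2 * pi}. g (p + r *\<^sub>R unit_vec t))"
      unfolding set_lebesgue_integral_def integral_mult_right_zero[symmetric]
      by (rule Bochner_Integration.integral_cong) (simp_all add: F)
    then show ?thesis by (simp add: circular_mean_eq)
  qed
  have "integrable (lborel \<Otimes>\<^sub>M lborel) (case_prod F)"
  proof (rule lborel_pair.Fubini_integrable)
    show "integrable lborel (\<lambda>r. \<integral>t. norm (case_prod F (r, t)) \<partial>lborel)"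
    proof (rule Bochner_Integration.integrable_bound)
      show "integrable lborel (\<lambda>r. (2 * pi * B * C) * (indicator {0..B} r *\<^sub>R h r))"
        using h unfolding set_integrable_def by (rule integrable_mult_right)
      show "AE r in lborel. norm (\<integral>t. norm (case_prod F (r, t)) \<partial>lborel) \<le> norm ((2 * pi * B * C) * (indicator {0..B} r *\<^sub>R h r))"
      proof (rule AE_I2)
        fix r :: real
        have "(\<integral>t. norm (F r t) \<partial>lborel) \<le> (\<integral>t. indicator {0..<2*pi} t *\<^sub>R (indicator {0..B} r * B * \<bar>h r\<bar> * C) \<partial>lborel)"
        proof (rule integral_mono)
          show "norm (F r t) \<le> indicator {0..<2*pi} t *\<^sub>R (indicator {0..B} r * B * \<bar>h r\<bar> * C)" for t
            using C[of "p + r *\<^sub>R unit_vec t"] C0 B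
            by (auto simp: F indicator_def abs_mult intro!: mult_mono)
        qed (use Ft in auto)
        also have "\<dots> = 2 * pi * (indicator {0..B} r * B * \<bar>h r\<bar> * C)"
          by simp
        also have "\<dots> = norm ((2 * pi * B * C) * (indicator {0..B} r *\<^sub>R h r))"
          using B C0 by (simp add: abs_mult)
        finally show "norm (\<integral>t. norm (case_prod F (r, t)) \<partial>lborel) \<le> norm ((2 * pi * B * C) * (indicator {0..B} r *\<^sub>R h r))"
          by simp
      qed
    qed simp
  qed (use Ft in auto)
  then have I: "integrable (lborel \<Otimes>\<^sub>M lborel) (\<lambda>(r, t). F r t)" .
  have Fe: "(\<lambda>(r, t). F r t) = (\<lambda>(r, t). indicator polar_domain (r, t) * r *
      (g (p + r *\<^sub>R unit_vec t) * h (norm (p + r *\<^sub>R unit_vec t - p))))"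
    by (auto simp: F_def fun_eq_iff polar_domain_def indicator_def)
  show ?A
    by (subst polar_integrable_iff[of _ p]) (use I in \<open>simp_all add: Fe\<close>)
  have ae: "AE r in lborel. indicator {0<..B} r * (2 * pi * (r * circular_mean g p r * h r)) =
      2 * pi * (indicator {0..B} r *\<^sub>R (r * circular_mean g p r * h r))"
    using AE_lborel_singleton[of "0::real"] by eventually_elim (auto simp: indicator_def)
  have [measurable]: "(\<lambda>r. circular_mean g p r) \<in> borel_measurable borel"
    unfolding circular_mean_eq[OF \<open>g \<in> borel_measurable borel\<close>] set_lebesgue_integral_def
    by measurable
  have "integrable lborel (\<lambda>r. indicator {0<..B} r * (2 * pi * (r * circular_mean g p r * h r)))"
    using lborel_pair.integrable_fst[OF I] by (simp add: F_int)
  then have "integrable lborel (\<lambda>r. 2 * pi * (indicator {0..B} r *\<^sub>R (r * circular_mean g p r * h r)))"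
    by (rule integrable_cong_AE_imp) (use ae in auto)
  from integrable_mult_right[OF this, of "1 / (2 * pi)"] show ?B by (simp add: set_integrable_def)
  have "integral\<^sup>L lborel (\<lambda>y. g y * h (norm (y - p))) = (\<integral>r. (\<integral>t. F r t \<partial>lborel) \<partial>lborel)"
    by (subst polar_integral_eq[of _ p]) (simp_all add: lborel_pair.integral_fst[OF I] Fe)
  also have "\<dots> = (\<integral>r. 2 * pi * (indicator {0..B} r *\<^sub>R (r * circular_mean g p r * h r)) \<partial>lborel)"
    unfolding F_int by (rule integral_cong_AE) (use ae in auto)
  finally show ?C by (simp add: set_lebesgue_integral_def)
qed

section \<open>Functions of class \<open>C\<^sup>k\<close> and integrals against a fixed kernel\<close>

lemma Ck_on_imp_continuous_on: "Ck_on k S f \<Longrightarrow> continuous_on S f"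
  by (cases k) (auto intro!: continuous_at_imp_continuous_on differentiable_imp_continuous_within)

lemma has_derivative_partial_deriv:
  assumes "f differentiable (at x)"
  shows "(f has_derivative (\<lambda>h. \<Sum>i\<in>UNIV. h $ i * partial_deriv i f x)) (at x)"
proof -
  have d: "(f has_derivative frechet_derivative f (at x)) (at x)"
    using assms by (simp add: frechet_derivative_works)
  interpret linear "frechet_derivative f (at x)" using d by (rule has_derivative_linear)
  have "frechet_derivative f (at x) h = (\<Sum>i\<in>UNIV. h $ i * partial_deriv i f x)" for h
  proof -
    have "frechet_derivative f (at x) h = frechet_derivative f (at x) (\<Sum>i\<in>UNIV. h $ i *\<^sub>R axis i 1)"
      by (simp only: basis_expansion scalar_mult_eq_scaleR[symmetric])
    then show ?thesis by (simp add: sum scale partial_deriv_def)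
  qed
  then have "frechet_derivative f (at x) = (\<lambda>h. \<Sum>i\<in>UNIV. h $ i * partial_deriv i f x)" by auto
  with d show ?thesis by simp
qed

lemma partial_deriv_unique:
  assumes "(f has_derivative (\<lambda>h. \<Sum>j\<in>UNIV. h $ j * c j)) (at x)"
  shows "partial_deriv i f x = c i"
proof -
  have "frechet_derivative f (at x) = (\<lambda>h. \<Sum>j\<in>UNIV. h $ j * c j)"
    using frechet_derivative_at[OF assms] by simp
  then have "partial_deriv i f x = (\<Sum>j\<in>UNIV. axis i 1 $ j * c j)"
    by (simp only: partial_deriv_def)
  also have "\<dots> = (\<Sum>j\<in>UNIV. if j = i then c j else 0)"
    by (rule sum.cong) (auto simp: axis_def)
  finally show ?thesis by simp
qed

text \<open>
  Partial derivatives are defined through the full derivative, which is local but only determined where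
  it exists; this is why differentiability is assumed.
\<close>

lemma partial_deriv_cong_open:
  assumes "open S" "x \<in> S" "\<And>y. y \<in> S \<Longrightarrow> f y = g y" "g differentiable (at x)"
  shows "partial_deriv i f x = partial_deriv i g x"
proof -
  have "(f has_derivative (\<lambda>h. \<Sum>i\<in>UNIV. h $ i * partial_deriv i g x)) (at x)"
    using has_derivative_partial_deriv[OF assms(4)] assms(1,2)
    by (rule has_derivative_transform_within_open) (simp add: assms(3))
  then show ?thesis by (rule partial_deriv_unique)
qed

lemma Ck_on_cong_open:
  assumes "open S" "\<And>y. y \<in> S \<Longrightarrow> f y = g y" "Ck_on k S g"
  shows "Ck_on k S f"
  using assms(2,3)
proof (induction k arbitrary: f g)
  case 0
  then show ?case by (simp cong: continuous_on_cong)
next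
  case (Suc k)
  have "f differentiable (at x)" if "x \<in> S" for x
  proof -
    have "g differentiable (at x)" using Suc.prems that by simp
    then obtain D where "(g has_derivative D) (at x)" unfolding differentiable_def by blast
    then have "(f has_derivative D) (at x)"
      using assms(1) that by (rule has_derivative_transform_within_open) (simp add: Suc.prems)
    then show ?thesis by (auto simp: differentiable_def)
  qed
  moreover have "Ck_on k S (partial_deriv i f)" for i
  proof (rule Suc.IH[of _ "partial_deriv i g"])
    fix y assume "y \<in> S"
    then show "partial_deriv i f y = partial_deriv i g y"
      by (intro partial_deriv_cong_open[OF assms(1)]) (use Suc.prems in auto)
  qed (use Suc.prems in auto)
  ultimately show ?case by simp
qed

lemma Ck_on_subset: "Ck_on k S f \<Longrightarrow> T \<subseteq> S \<Longrightarrow> Ck_on k T f"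
  by (induction k arbitrary: f) (auto intro: continuous_on_subset)

lemma laplacian_cong_open:
  assumes "open S" "x \<in> S" "\<And>y. y \<in> S \<Longrightarrow> f y = g y" "Ck_on 2 S g"
  shows "laplacian f x = laplacian g x"
  unfolding laplacian_def
proof (rule sum.cong[OF refl], rule partial_deriv_cong_open[OF assms(1,2)])
  fix i y assume "y \<in> S"
  then show "partial_deriv i f y = partial_deriv i g y"
    using assms by (intro partial_deriv_cong_open[OF assms(1)]) (auto simp: numeral_2_eq_2)
qed (use assms in \<open>auto simp: numeral_2_eq_2\<close>)

lemma smooth_on_partial_deriv: "smooth_on S f \<Longrightarrow> smooth_on S (partial_deriv i f)"
  unfolding smooth_on_def using Ck_on.simps(2) by blast

lemma smooth_on_differentiable: "smooth_on S f \<Longrightarrow> x \<in> S \<Longrightarrow> f differentiable (at x)"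
  unfolding smooth_on_def using Ck_on.simps(2) by blast

lemma smooth_on_continuous_on: "smooth_on S f \<Longrightarrow> continuous_on S f"
  unfolding smooth_on_def using Ck_on.simps(1) by blast

lemma smooth_on_continuous_on_laplacian: "smooth_on S f \<Longrightarrow> continuous_on S (laplacian f)"
  unfolding laplacian_def
  by (intro continuous_on_sum smooth_on_continuous_on smooth_on_partial_deriv)

lemma partial_deriv_eq_0_outside:
  assumes "\<And>y. norm y > R \<Longrightarrow> f y = 0" "norm y > R"
  shows "partial_deriv i f y = 0"
proof -
  have "open {y::real^'n. norm y > R}" by (intro open_Collect_less continuous_intros)
  then have "partial_deriv i f y = partial_deriv i (\<lambda>_. 0) y"
    by (rule partial_deriv_cong_open) (use assms in auto)
  then show ?thesis by (simp add: partial_deriv_def)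
qed

lemma laplacian_eq_0_outside:
  assumes "\<And>y. norm y > R \<Longrightarrow> f y = 0" "norm y > R"
  shows "laplacian f y = 0"
  unfolding laplacian_def
  by (intro sum.neutral ballI partial_deriv_eq_0_outside[of R]) (use assms in auto)

text \<open>
  The kernel sits at the origin and the function is translated, so that differentiating in \<open>x\<close> only
  touches \<open>u\<close>.
\<close>

definition kernel_integral :: "(real ^ 'n \<Rightarrow> real) \<Rightarrow> (real ^ 'n \<Rightarrow> real) \<Rightarrow> real ^ 'n \<Rightarrow> real" where
  "kernel_integral W u x = (\<integral>z. W z * u (x + z) \<partial>lborel)"

lemma compact_support_uniformly_continuous:
  fixes u :: "'a::euclidean_space \<Rightarrow> real"
  assumes u: "continuous_on UNIV u" and supp: "\<And>y. norm y > R \<Longrightarrow> u y = 0"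
  shows "uniformly_continuous_on UNIV u"
proof -
  have c: "uniformly_continuous_on (cball 0 (\<bar>R\<bar> + 1)) u"
    by (intro compact_uniformly_continuous continuous_on_subset[OF u]) auto
  show ?thesis
    unfolding uniformly_continuous_on_def
  proof safe
    fix e :: real assume "e > 0"
    with c obtain d where d: "d > 0"
      "\<And>x y. \<lbrakk>x \<in> cball 0 (\<bar>R\<bar> + 1); y \<in> cball 0 (\<bar>R\<bar> + 1); dist y x < d\<rbrakk> \<Longrightarrow> dist (u y) (u x) < e"
      unfolding uniformly_continuous_on_def by metis
    show "\<exists>d>0. \<forall>x\<in>UNIV. \<forall>y\<in>UNIV. dist y x < d \<longrightarrow> dist (u y) (u x) < e"
    proof (intro exI[of _ "min d 1"] conjI ballI impI)
      fix x y :: 'a assume xy: "dist y x < min d 1"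
      show "dist (u y) (u x) < e"
      proof (cases "norm x \<le> \<bar>R\<bar> + 1 \<and> norm y \<le> \<bar>R\<bar> + 1")
        case True
        then show ?thesis using d(2)[of x y] xy by auto
      next
        case False
        moreover have "norm x \<le> norm y + dist y x" "norm y \<le> norm x + dist y x"
          using norm_triangle_sub[of x y] norm_triangle_sub[of y x] by (auto simp: dist_norm norm_minus_commute)
        ultimately have "norm x > R" "norm y > R" using xy by auto
        then show ?thesis using supp \<open>e > 0\<close> by simp
      qed
    qed (use d in auto)
  qed
qed

lemma kernel_integrable:
  fixes W u :: "real ^ 'n \<Rightarrow> real"
  assumes W: "\<And>B. set_integrable lborel (cball 0 B) W" and [measurable]: "W \<in> borel_measurable borel"
    and u: "continuous_on UNIV u" and supp: "\<And>y. norm y > R \<Longrightarrow> u y = 0"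
  shows "integrable lborel (\<lambda>z. W z * u (x + z))"
proof -
  have [measurable]: "u \<in> borel_measurable borel" using u by (rule borel_measurable_continuous_onI)
  obtain C where C: "\<And>y. \<bar>u y\<bar> \<le> C" using bounded_of_compact_support[OF u supp] by blast
  show ?thesis
  proof (rule Bochner_Integration.integrable_bound)
    show "integrable lborel (\<lambda>z. C * (indicator (cball 0 (R + norm x)) z *\<^sub>R W z))"
      using W unfolding set_integrable_def by (intro integrable_mult_right)
    show "AE z in lborel. norm (W z * u (x + z)) \<le> norm (C * (indicator (cball 0 (R + norm x)) z *\<^sub>R W z))"
    proof (rule AE_I2)
      fix z
      have C0: "C \<ge> 0" using C[of 0] by linarith
      show "norm (W z * u (x + z)) \<le> norm (C * (indicator (cball 0 (R + norm x)) z *\<^sub>R W z))"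
      proof (cases "norm z \<le> R + norm x")
        case True
        then show ?thesis using mult_right_mono[OF C[of "x + z"], of "\<bar>W z\<bar>"] C0
          by (simp add: abs_mult mult.commute)
      next
        case False
        then have "norm (x + z) > R" using norm_triangle_ineq4[of "x + z" x] by simp
        then show ?thesis using supp by simp
      qed
    qed
  qed measurable
qed

text \<open>
  The mean value theorem along the segment from \<open>y\<close> to \<open>y + h\<close> compares the gradient at two points
  at distance at most \<open>\<bar>h\<bar>\<close>; compact support makes the gradient uniformly continuous, so the bound does
  not depend on \<open>y\<close>.
\<close>

lemma uniform_taylor_bound:
  fixes u :: "real ^ 'n \<Rightarrow> real"
  assumes u: "Ck_on 1 UNIV u" and supp: "\<And>y. norm y > R \<Longrightarrow> u y = 0" and e: "e > 0"
  obtains d where "d > 0"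
    "\<And>y h. norm h < d \<Longrightarrow> \<bar>u (y + h) - u y - (\<Sum>i\<in>UNIV. h $ i * partial_deriv i u y)\<bar> \<le> e * norm h"
proof -
  define c where "c = e / real CARD('n)"
  have c: "c > 0" using e by (simp add: c_def)
  have "\<forall>i. \<exists>d>0. \<forall>x y. dist y x < d \<longrightarrow> dist (partial_deriv i u y) (partial_deriv i u x) < c"
  proof
    fix i
    have "uniformly_continuous_on UNIV (partial_deriv i u)"
      by (rule compact_support_uniformly_continuous[of _ R]) (use u supp partial_deriv_eq_0_outside[of R u] in auto)
    then show "\<exists>d>0. \<forall>x y. dist y x < d \<longrightarrow> dist (partial_deriv i u y) (partial_deriv i u x) < c"
      using c unfolding uniformly_continuous_on_def by auto
  qed
  then obtain d where d: "\<And>i. d i > 0"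
    "\<And>i x y. dist y x < d i \<Longrightarrow> dist (partial_deriv i u y) (partial_deriv i u x) < c" by metis
  show ?thesis
  proof (rule that[of "Min (range d)"])
    show "Min (range d) > 0" using d(1) by (subst Min_gr_iff) auto
    fix y h :: "real ^ 'n" assume h: "norm h < Min (range d)"
    have hd: "norm h < d i" for i using h by (subst (asm) Min_gr_iff) auto
    have der: "((\<lambda>t. u (y + t *\<^sub>R h)) has_real_derivative (\<Sum>i\<in>UNIV. h $ i * partial_deriv i u (y + t *\<^sub>R h))) (at t)" for t
    proof -
      have 1: "((\<lambda>t. y + t *\<^sub>R h) has_derivative (\<lambda>s. s *\<^sub>R h)) (at t)"
        by (auto intro!: derivative_eq_intros)
      have "u differentiable at (y + t *\<^sub>R h)" using u by simp
      then have "((\<lambda>t. u (y + t *\<^sub>R h)) has_derivative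
          (\<lambda>s. \<Sum>i\<in>UNIV. (s *\<^sub>R h) $ i * partial_deriv i u (y + t *\<^sub>R h))) (at t)"
        by (rule has_derivative_compose[OF 1 has_derivative_partial_deriv])
      moreover have "(\<lambda>s. \<Sum>i\<in>UNIV. (s *\<^sub>R h) $ i * partial_deriv i u (y + t *\<^sub>R h)) =
          (*) (\<Sum>i\<in>UNIV. h $ i * partial_deriv i u (y + t *\<^sub>R h))"
        by (simp add: fun_eq_iff sum_distrib_left mult_ac)
      ultimately show ?thesis by (simp only: has_field_derivative_def)
    qed
    obtain t where t: "0 < t" "t < 1" "u (y + 1 *\<^sub>R h) - u (y + 0 *\<^sub>R h) = (1 - 0) * (\<Sum>i\<in>UNIV. h $ i * partial_deriv i u (y + t *\<^sub>R h))"
      using MVT2[of 0 1 "\<lambda>t. u (y + t *\<^sub>R h)", OF _ der] by auto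
    then have "u (y + h) - u y - (\<Sum>i\<in>UNIV. h $ i * partial_deriv i u y) =
       (\<Sum>i\<in>UNIV. h $ i * (partial_deriv i u (y + t *\<^sub>R h) - partial_deriv i u y))"
      by (simp add: right_diff_distrib sum_subtractf)
    also have "\<bar>\<dots>\<bar> \<le> (\<Sum>i\<in>(UNIV::'n set). norm h * c)"
    proof (rule order_trans[OF sum_abs sum_mono])
      fix i
      have "norm (t *\<^sub>R h) \<le> norm h" using t by (simp add: mult_left_le_one_le)
      then have "dist (y + t *\<^sub>R h) y < d i" using hd[of i] by (simp add: dist_norm)
      from d(2)[OF this] have "\<bar>partial_deriv i u (y + t *\<^sub>R h) - partial_deriv i u y\<bar> \<le> c"
        by (simp add: dist_real_def)
      then show "\<bar>h $ i * (partial_deriv i u (y + t *\<^sub>R h) - partial_deriv i u y)\<bar> \<le> norm h * c"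
        unfolding abs_mult using component_le_norm_cart[of h i] by (intro mult_mono) auto
    qed
    also have "\<dots> = e * norm h" by (simp add: c_def)
    finally show "\<bar>u (y + h) - u y - (\<Sum>i\<in>UNIV. h $ i * partial_deriv i u y)\<bar> \<le> e * norm h" .
  qed
qed

text \<open>
  The first-order Taylor error of \<open>u\<close> is \<open>o(\<bar>h\<bar>)\<close> uniformly in the base point, and for \<open>\<bar>h\<bar> < 1\<close> it vanishes for
  \<open>z\<close> outside a fixed ball, on which the kernel is integrable. So differentiation passes under the
  integral although the kernel itself may be singular.
\<close>

lemma kernel_integral_has_derivative:
  fixes W u :: "real ^ 'n \<Rightarrow> real"
  assumes W: "\<And>B. set_integrable lborel (cball 0 B) W" and [measurable]: "W \<in> borel_measurable borel"
    and u: "Ck_on 1 UNIV u" and supp: "\<And>y. norm y > R \<Longrightarrow> u y = 0"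
  shows "(kernel_integral W u has_derivative (\<lambda>h. \<Sum>i\<in>UNIV. h $ i * kernel_integral W (partial_deriv i u) x)) (at x)"
  unfolding has_derivative_at_alt
proof (intro conjI allI impI)
  show "bounded_linear (\<lambda>h. \<Sum>i\<in>UNIV. h $ i * kernel_integral W (partial_deriv i u) x)"
    by (intro bounded_linear_sum bounded_linear_compose[OF bounded_linear_mult_left bounded_linear_vec_nth])
  fix e :: real assume e: "e > 0"
  \<comment> \<open>For \<open>\<bar>h\<bar> < 1\<close> and \<open>\<bar>z\<bar> > B\<close>, both \<open>x + z\<close> and \<open>x + z + h\<close> lie outside the support.\<close>
  define B where "B = R + norm x + 1"
  define A where "A = (\<integral>z. \<bar>indicator (cball 0 B) z *\<^sub>R W z\<bar> \<partial>lborel)"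
  have A: "A \<ge> 0" unfolding A_def by (rule integral_nonneg_AE) auto
  have WA: "integrable lborel (\<lambda>z. \<bar>indicator (cball 0 B) z *\<^sub>R W z\<bar>)"
    using W[of B] unfolding set_integrable_def by (rule integrable_abs)
  \<comment> \<open>\<open>A + 1\<close> instead of \<open>A\<close>, which may be zero.\<close>
  have "e / (A + 1) > 0" using e A by simp
  from uniform_taylor_bound[OF u supp this] obtain d where d: "d > 0"
    "\<And>y h. norm h < d \<Longrightarrow> \<bar>u (y + h) - u y - (\<Sum>i\<in>UNIV. h $ i * partial_deriv i u y)\<bar> \<le> e / (A + 1) * norm h"
    by blast
  have uc: "continuous_on UNIV u" using u by (rule Ck_on_imp_continuous_on)
  have pc: "continuous_on UNIV (partial_deriv i u)" for i using u by simp
  note p0 = partial_deriv_eq_0_outside[of R u, OF supp]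
  note int = kernel_integrable[OF W _ uc supp] kernel_integrable[OF W _ pc p0]
  show "\<exists>d>0. \<forall>y. norm (y - x) < d \<longrightarrow> norm (kernel_integral W u y - kernel_integral W u x -
      (\<Sum>i\<in>UNIV. (y - x) $ i * kernel_integral W (partial_deriv i u) x)) \<le> e * norm (y - x)"
  proof (intro exI[of _ "min d 1"] conjI allI impI)
    fix y assume y: "norm (y - x) < min d 1"
    define h where "h = y - x"
    have h: "norm h < d" "norm h < 1" using y by (auto simp: h_def)
    define E where "E = (\<lambda>q. u (q + h) - u q - (\<Sum>i\<in>UNIV. h $ i * partial_deriv i u q))"
    have WE: "W z * E (x + z) = W z * u (y + z) - W z * u (x + z) - (\<Sum>i\<in>UNIV. h $ i * (W z * partial_deriv i u (x + z)))" for z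
      by (simp add: E_def h_def algebra_simps sum_distrib_left)
    have iE: "integrable lborel (\<lambda>z. W z * E (x + z))"
      unfolding WE by (intro Bochner_Integration.integrable_diff Bochner_Integration.integrable_sum integrable_mult_right int) auto
    have "kernel_integral W u y - kernel_integral W u x -
      (\<Sum>i\<in>UNIV. h $ i * kernel_integral W (partial_deriv i u) x) = (\<integral>z. W z * E (x + z) \<partial>lborel)"
      unfolding WE kernel_integral_def
      by (subst Bochner_Integration.integral_diff, (intro Bochner_Integration.integrable_diff int, auto)[],
          (intro Bochner_Integration.integrable_sum integrable_mult_right int, auto)[],
          subst Bochner_Integration.integral_diff, (intro int, auto)[], (intro int, auto)[],
          subst Bochner_Integration.integral_sum, (intro integrable_mult_right int, auto)[]) simp
    also have "norm \<dots> \<le> (\<integral>z. \<bar>indicator (cball 0 B) z *\<^sub>R W z\<bar> * (e / (A + 1) * norm h) \<partial>lborel)"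
    proof (rule order_trans[OF integral_norm_bound integral_mono])
      fix z
      show "norm (W z * E (x + z)) \<le> \<bar>indicator (cball 0 B) z *\<^sub>R W z\<bar> * (e / (A + 1) * norm h)"
      proof (cases "norm z \<le> B")
        case True
        have "\<bar>E (x + z)\<bar> \<le> e / (A + 1) * norm h" using d(2)[OF h(1), of "x + z"] by (simp add: E_def)
        from mult_left_mono[OF this, of "\<bar>W z\<bar>"] True show ?thesis by (simp add: abs_mult)
      next
        case False
        have "norm z \<le> norm (x + z) + norm x" "norm z \<le> norm (x + z + h) + norm x + norm h"
          using norm_triangle_ineq4[of "x + z" x] norm_triangle_ineq4[of "x + z + h" "x + h"] norm_triangle_ineq[of x h]
          by simp_all
        then have "norm (x + z) > R" "norm (x + z + h) > R" using False h(2) by (auto simp: B_def)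
        then show ?thesis using supp p0 False by (simp add: E_def)
      qed
    qed (use iE WA in auto)
    also have "\<dots> = A / (A + 1) * (e * norm h)" by (simp add: A_def)
    also have "\<dots> \<le> e * norm h" using A e by (intro mult_left_le_one_le) auto
    finally show "norm (kernel_integral W u y - kernel_integral W u x -
      (\<Sum>i\<in>UNIV. (y - x) $ i * kernel_integral W (partial_deriv i u) x)) \<le> e * norm (y - x)"
      by (simp add: h_def)
  qed (use d in auto)
qed

lemma kernel_integral_partial_deriv:
  fixes W u :: "real ^ 'n \<Rightarrow> real"
  assumes "\<And>B. set_integrable lborel (cball 0 B) W" "W \<in> borel_measurable borel"
    and "Ck_on 1 UNIV u" and "\<And>y. norm y > R \<Longrightarrow> u y = 0"
  shows "partial_deriv i (kernel_integral W u) = kernel_integral W (partial_deriv i u)"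
  using partial_deriv_unique[OF kernel_integral_has_derivative[OF assms]] by auto

lemma kernel_integral_smooth:
  fixes W u :: "real ^ 'n \<Rightarrow> real"
  assumes W: "\<And>B. set_integrable lborel (cball 0 B) W" "W \<in> borel_measurable borel"
    and "smooth_on UNIV u" and "\<And>y. norm y > R \<Longrightarrow> u y = 0"
  shows "smooth_on UNIV (kernel_integral W u)"
proof -
  have "Ck_on k UNIV (kernel_integral W u)" for k
    using assms(3,4)
  proof (induction k arbitrary: u)
    case (Suc k)
    have u: "Ck_on 1 UNIV u" using Suc.prems unfolding smooth_on_def by blast
    have "Ck_on k UNIV (kernel_integral W (partial_deriv i u))" for i
      using Suc.prems by (intro Suc.IH smooth_on_partial_deriv partial_deriv_eq_0_outside[of R u])
    then show ?case
      using kernel_integral_has_derivative[OF W u Suc.prems(2)] kernel_integral_partial_deriv[OF W u Suc.prems(2)]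
      by (auto simp: differentiable_def)
  next
    case 0
    have u: "Ck_on 1 UNIV u" using 0 unfolding smooth_on_def by blast
    show ?case
      using kernel_integral_has_derivative[OF W u 0(2)]
      by (auto intro!: continuous_at_imp_continuous_on has_derivative_continuous)
  qed
  then show ?thesis by (simp add: smooth_on_def)
qed

lemma kernel_integral_laplacian:
  fixes W u :: "real ^ 'n \<Rightarrow> real"
  assumes W: "\<And>B. set_integrable lborel (cball 0 B) W" "W \<in> borel_measurable borel"
    and u: "smooth_on UNIV u" and supp: "\<And>y. norm y > R \<Longrightarrow> u y = 0"
  shows "laplacian (kernel_integral W u) x = kernel_integral W (laplacian u) x"
proof -
  note p = smooth_on_partial_deriv[OF u]
  note p0 = partial_deriv_eq_0_outside[of R u, OF supp]
  have C1: "Ck_on 1 UNIV v" if "smooth_on UNIV v" for v :: "real ^ 'n \<Rightarrow> real"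
    using that unfolding smooth_on_def by blast
  have "laplacian (kernel_integral W u) x = (\<Sum>i\<in>UNIV. kernel_integral W (partial_deriv i (partial_deriv i u)) x)"
    unfolding laplacian_def
    by (simp add: kernel_integral_partial_deriv[OF W C1[OF u] supp] kernel_integral_partial_deriv[OF W C1[OF p] p0])
  also have "\<dots> = kernel_integral W (laplacian u) x"
    unfolding kernel_integral_def laplacian_def sum_distrib_left
    by (rule Bochner_Integration.integral_sum[symmetric])
       (rule kernel_integrable[OF W smooth_on_continuous_on[OF smooth_on_partial_deriv[OF p]]
          partial_deriv_eq_0_outside[OF p0]])
  finally show ?thesis .
qed

section \<open>Exchanging the centre and the plane integral\<close>

text \<open>
  Scaling the distance by \<open>R\<close> adds \<open>ln R\<close> times the total mass of \<open>g\<close> to the usual potential; with this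
  constant the kernel is exactly the mean of the circle kernel.
\<close>

definition log_potential :: "real \<Rightarrow> (real ^ 2 \<Rightarrow> real) \<Rightarrow> real ^ 2 \<Rightarrow> real" where
  "log_potential R g x = (\<integral>z. ln (R * norm z) * g (x + z) \<partial>lborel)"

lemma set_integrable_ln_cmult:
  fixes a b R :: real
  assumes "R > 0"
  shows "set_integrable lborel {a..b} (\<lambda>r. ln \<bar>R * r\<bar>)"
proof -
  have "set_integrable lborel {a..b} (\<lambda>r. ln R + ln \<bar>r\<bar>)"
    by (intro set_integral_add set_integrable_ln_abs borel_integrable_atLeastAtMost' continuous_intros)
  moreover have "AE r in lborel. r \<in> {a..b} \<longrightarrow> ln R + ln \<bar>r\<bar> = ln \<bar>R * r\<bar>"
    using AE_lborel_singleton[of "0::real"]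
    by eventually_elim (use assms in \<open>simp add: ln_mult abs_mult\<close>)
  ultimately show ?thesis by (subst set_integrable_cong_AE[symmetric]) auto
qed

lemma integral_lborel_translate:
  fixes u :: "'a::euclidean_space \<Rightarrow> real"
  assumes "u \<in> borel_measurable borel"
  shows "integral\<^sup>L lborel u = (\<integral>z. u (x + z) \<partial>lborel)"
  by (subst lborel_distr_plus[of x, symmetric], subst integral_distr) (use assms in auto)

lemma ln_norm_integrable:
  fixes g :: "real ^ 2 \<Rightarrow> real"
  assumes g: "continuous_on UNIV g" and R: "R > 0" and B: "B \<ge> 0"
    and supp: "\<And>y. norm (y - x) > B \<Longrightarrow> g y = 0"
  shows "integrable lborel (\<lambda>y. g y * ln (R * norm (y - x)))"
  using radial_weight_integral(1)[OF g _ set_integrable_ln_cmult[OF R] B supp] R by (simp add: abs_mult)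

lemma log_potential_eq:
  assumes [measurable]: "g \<in> borel_measurable borel"
  shows "log_potential R g x = (\<integral>y. g y * ln (R * norm (y - x)) \<partial>lborel)"
  unfolding log_potential_def by (subst (2) integral_lborel_translate[of _ x]) (simp_all add: mult.commute)

text \<open>
  Both sides are \<open>1 / (2 \<pi>)\<close> times the double integral of \<open>g(y) L(y,p)\<close> with \<open>L(y,p) = ln \<bar> \<bar>y - p\<bar>\<^sup>2 - \<bar>x - p\<bar>\<^sup>2 \<bar>\<close>, taken in
  the two orders. For the exchange, absolute values are integrated over \<open>p\<close> first: on the support \<open>L\<close>
  is bounded above by a constant \<open>K \<ge> 0\<close>, hence \<open>\<bar>L\<bar> \<le> 2 K - L\<close>, and the integral of \<open>L\<close> over \<open>p\<close> is known
  and only has a logarithmic singularity at \<open>y = x\<close>.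
\<close>

lemma circular_mean_log_integral:
  fixes g :: "real ^ 2 \<Rightarrow> real"
  assumes R: "R > 0" and g: "continuous_on UNIV g" and supp: "\<And>y. norm y > R \<Longrightarrow> g y = 0"
    and x: "x \<in> ball 0 R"
  shows "iterated_integrable R (\<lambda>p r. r * circular_mean g p r * ln \<bar>r\<^sup>2 - (norm (x - p))\<^sup>2\<bar>)" (is ?A)
    and "(LINT p|circle_arc_length R. (LBINT r:{0..2 * R}.
            r * circular_mean g p r * ln \<bar>r\<^sup>2 - (norm (x - p))\<^sup>2\<bar>)) = R * log_potential R g x" (is ?B)
proof -
  have [measurable]: "g \<in> borel_measurable borel" using g by (rule borel_measurable_continuous_onI)
  define L where "L = (\<lambda>y p. ln \<bar>(norm (y - p))\<^sup>2 - (norm (x - p))\<^sup>2\<bar>)"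
  define inner where "inner = (\<lambda>p. LBINT r:{0..2 * R}. r * circular_mean g p r * ln \<bar>r\<^sup>2 - (norm (x - p))\<^sup>2\<bar>)"
  have xR: "norm x < R" using x by simp
  have far: "g y = 0" if "norm (y - p) > 2 * R" "norm p \<le> R" for y p
    using that norm_triangle_ineq4[of y p] by (intro supp) linarith
  have si: "set_integrable lborel {0..2 * R} (\<lambda>r. r * circular_mean g p r * ln \<bar>r\<^sup>2 - (norm (x - p))\<^sup>2\<bar>)"
    and inner: "inner p = 1 / (2 * pi) * (\<integral>y. g y * L y p \<partial>lborel)" if "p \<in> sphere 0 R" for p
    using radial_weight_integral(2,3)[OF g _ set_integrable_ln_abs_diff_squares[of 0 "2 * R" "norm (x - p)"], of p]
      far[of _ p] R that
    by (auto simp: inner_def L_def)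
  interpret C: finite_measure "circle_arc_length R" by (rule finite_measure_circle_arc_length)
  interpret P: pair_sigma_finite "lborel :: (real ^ 2) measure" "circle_arc_length R" ..
  \<comment> \<open>Both squared distances are at most \<open>4 R\<^sup>2\<close>; adding \<open>1\<close> makes the logarithm nonnegative for small \<open>R\<close> and also
     covers the default value \<open>ln 0 = 0\<close>.\<close>
  define K where "K = ln (4 * R\<^sup>2 + 1)"
  have K: "K \<ge> 0" by (simp add: K_def)
  have LK: "L y p \<le> K" if "norm y \<le> R" "p \<in> sphere 0 R" for y p
  proof -
    have "norm (y - p) \<le> 2 * R" "norm (x - p) \<le> 2 * R"
      using that xR norm_triangle_ineq4[of y p] norm_triangle_ineq4[of x p] by auto
    then have "(norm (y - p))\<^sup>2 \<le> (2 * R)\<^sup>2" "(norm (x - p))\<^sup>2 \<le> (2 * R)\<^sup>2"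
      by (simp_all only: power_mono norm_ge_zero)
    then have "\<bar>(norm (y - p))\<^sup>2 - (norm (x - p))\<^sup>2\<bar> \<le> 4 * R\<^sup>2 + 1"
      using zero_le_power2[of "norm (y - p)"] zero_le_power2[of "norm (x - p)"]
        power_mult_distrib[of 2 R 2] unfolding abs_le_iff by (intro conjI; simp only: power2_eq_square; linarith)
    then show ?thesis unfolding L_def K_def by (intro ln_mono') auto
  qed
  have Lint: "integrable (circle_arc_length R) (L y)"
    "integral\<^sup>L (circle_arc_length R) (L y) = 2 * pi * R * ln (R * norm (y - x))"
    if "norm y \<le> R" "y \<noteq> x" for y
    using log_kernel_integral[OF R _ that(1), of x] xR that(2)
    by (simp_all add: L_def has_bochner_integral_iff norm_minus_commute)
  have gL: "integrable (circle_arc_length R) (\<lambda>p. g y * L y p)"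
    "(\<integral>p. g y * L y p \<partial>circle_arc_length R) = g y * (2 * pi * R * ln (R * norm (y - x)))"
    if "y \<noteq> x" for y
    using Lint[of y] supp[of y] that by (cases "norm y \<le> R"; simp)+
  define M where "M = measure (circle_arc_length R) UNIV"
  have g_abs: "continuous_on UNIV (\<lambda>y. \<bar>g y\<bar>)" using g by (intro continuous_intros)
  have g_int: "integrable lborel (\<lambda>y. \<bar>g y\<bar>)"
    using radial_weight_integral(1)[OF g_abs, of "\<lambda>_. 1" R 0] R supp by (simp add: set_integrable_def)
  have pot_abs: "integrable lborel (\<lambda>y. \<bar>g y\<bar> * ln (R * norm (y - x)))"
    using R far[of _ x] xR by (intro ln_norm_integrable[where B = "2 * R"] g_abs) auto
  have pot: "integrable lborel (\<lambda>y. g y * ln (R * norm (y - x)))"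
    using R far[of _ x] xR by (intro ln_norm_integrable[where B = "2 * R"] g) auto
  have "integrable (lborel \<Otimes>\<^sub>M circle_arc_length R) (\<lambda>(y, p). g y * L y p)"
  proof (rule P.Fubini_integrable)
    show "(\<lambda>(y, p). g y * L y p) \<in> borel_measurable (lborel \<Otimes>\<^sub>M circle_arc_length R)"
      unfolding L_def by measurable
    show "integrable lborel (\<lambda>y. \<integral>p. norm (case (y, p) of (y, p) \<Rightarrow> g y * L y p) \<partial>circle_arc_length R)"
    proof (rule Bochner_Integration.integrable_bound)
      show "integrable lborel (\<lambda>y. \<bar>g y\<bar> * (2 * K * M) - 2 * pi * R * (\<bar>g y\<bar> * ln (R * norm (y - x))))"
        using pot_abs g_int by (intro Bochner_Integration.integrable_diff integrable_mult_right integrable_mult_left)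
      show "AE y in lborel. norm (\<integral>p. norm (case (y, p) of (y, p) \<Rightarrow> g y * L y p) \<partial>circle_arc_length R)
          \<le> norm (\<bar>g y\<bar> * (2 * K * M) - 2 * pi * R * (\<bar>g y\<bar> * ln (R * norm (y - x))))"
        using AE_lborel_singleton[of x]
      proof eventually_elim
        case (elim y)
        show ?case
        proof (cases "norm y \<le> R")
          case True
          have "(\<integral>p. \<bar>L y p\<bar> \<partial>circle_arc_length R) \<le> (\<integral>p. 2 * K - L y p \<partial>circle_arc_length R)"
          proof (rule integral_mono_AE)
            show "AE p in circle_arc_length R. \<bar>L y p\<bar> \<le> 2 * K - L y p"
              using AE_circle_arc_length[OF R]
            proof eventually_elim
              case (elim p)
              from LK[OF True elim] K show ?case by linarith
            qed
          qed (use Lint[OF True elim] in auto)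
          also have "\<dots> = 2 * K * M - 2 * pi * R * ln (R * norm (y - x))"
            using Lint[OF True elim] by (simp add: M_def)
          finally have "\<bar>g y\<bar> * (\<integral>p. \<bar>L y p\<bar> \<partial>circle_arc_length R) \<le>
              \<bar>g y\<bar> * (2 * K * M - 2 * pi * R * ln (R * norm (y - x)))"
            by (intro mult_left_mono) auto
          moreover have "0 \<le> \<bar>g y\<bar> * (\<integral>p. \<bar>L y p\<bar> \<partial>circle_arc_length R)"
            by (intro mult_nonneg_nonneg integral_nonneg) auto
          ultimately show ?thesis by (simp add: abs_mult algebra_simps)
        qed (use supp in auto)
      qed
    qed (unfold L_def, measurable)
    show "AE y in lborel. integrable (circle_arc_length R) (\<lambda>p. case (y, p) of (y, p) \<Rightarrow> g y * L y p)"
      using AE_lborel_singleton[of x] by eventually_elim (use gL in auto)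
  qed
  note I = this
  have ae: "AE p in circle_arc_length R. 1 / (2 * pi) * (\<integral>y. g y * L y p \<partial>lborel) = inner p"
    using AE_circle_arc_length[OF R] by eventually_elim (simp add: inner)
  have [measurable]: "inner \<in> borel_measurable borel"
    unfolding inner_def circular_mean_eq[OF \<open>g \<in> borel_measurable borel\<close>] set_lebesgue_integral_def
    by measurable
  have "integrable (circle_arc_length R) inner"
    by (rule integrable_cong_AE_imp[OF integrable_mult_right[where c = "1 / (2 * pi)", OF P.integrable_snd[OF I]]])
       (use ae in auto)
  then show ?A using si by (simp add: iterated_integrable_def inner_def)
  show ?B
  proof -
    have "integral\<^sup>L (circle_arc_length R) inner = (\<integral>p. 1 / (2 * pi) * (\<integral>y. g y * L y p \<partial>lborel) \<partial>circle_arc_length R)"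
      using ae P.integrable_snd[OF I] by (intro integral_cong_AE) (auto simp: eq_commute)
    also have "\<dots> = 1 / (2 * pi) * (\<integral>y. (\<integral>p. g y * L y p \<partial>circle_arc_length R) \<partial>lborel)"
      by (simp add: P.Fubini_integral[OF I])
    also have "(\<integral>y. (\<integral>p. g y * L y p \<partial>circle_arc_length R) \<partial>lborel) =
        (\<integral>y. 2 * pi * R * (g y * ln (R * norm (y - x))) \<partial>lborel)"
    proof (rule integral_cong_AE)
      show "(\<lambda>y. \<integral>p. g y * L y p \<partial>circle_arc_length R) \<in> borel_measurable lborel"
        by (rule borel_measurable_integrable[OF P.integrable_fst[OF I]])
      show "AE y in lborel. (\<integral>p. g y * L y p \<partial>circle_arc_length R) = 2 * pi * R * (g y * ln (R * norm (y - x)))"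
        using AE_lborel_singleton[of x] by eventually_elim (rule trans[OF gL(2)], assumption, simp)
    qed measurable
    finally show ?thesis by (simp add: inner_def log_potential_eq)
  qed
qed

section \<open>The Darboux equation and the inversion formulas\<close>

lemma circular_mean_eq_integral:
  assumes g: "continuous_on UNIV g"
  shows "circular_mean g p r = 1 / (2 * pi) * integral {0..2 * pi} (\<lambda>t. g (p + r *\<^sub>R unit_vec t))"
proof -
  have c: "continuous_on {0..2 * pi} (\<lambda>t. g (p + r *\<^sub>R unit_vec t))"
    by (intro continuous_on_compose2[OF g] continuous_intros) auto
  have "(LBINT t:{0..<2 * pi}. g (p + r *\<^sub>R unit_vec t)) = (LBINT t:{0..2 * pi}. g (p + r *\<^sub>R unit_vec t))"
    unfolding set_lebesgue_integral_def
  proof (rule integral_cong_AE)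
    have [measurable]: "g \<in> borel_measurable borel" using g by (rule borel_measurable_continuous_onI)
    show "(\<lambda>t. indicator {0..<2 * pi} t *\<^sub>R g (p + r *\<^sub>R unit_vec t)) \<in> borel_measurable lborel"
      "(\<lambda>t. indicator {0..2 * pi} t *\<^sub>R g (p + r *\<^sub>R unit_vec t)) \<in> borel_measurable lborel"
      by measurable
    show "AE t in lborel. indicator {0..<2 * pi} t *\<^sub>R g (p + r *\<^sub>R unit_vec t) =
        indicator {0..2 * pi} t *\<^sub>R g (p + r *\<^sub>R unit_vec t)"
      using AE_lborel_singleton[of "2 * pi"] by eventually_elim (auto simp: indicator_def)
  qed
  also have "\<dots> = integral {0..2 * pi} (\<lambda>t. g (p + r *\<^sub>R unit_vec t))"
    by (intro set_borel_integral_eq_integral borel_integrable_atLeastAtMost' c)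
  finally show ?thesis using circular_mean_eq[OF borel_measurable_continuous_onI[OF g]] by simp
qed

lemma chain_rule_curve:
  fixes u :: "real ^ 2 \<Rightarrow> real"
  assumes "u differentiable (at (q t))" "(q has_vector_derivative v) (at t)"
  shows "((\<lambda>t. u (q t)) has_real_derivative v $ 1 * partial_deriv 1 u (q t) + v $ 2 * partial_deriv 2 u (q t)) (at t)"
proof -
  have "((\<lambda>t. u (q t)) has_derivative (\<lambda>s. \<Sum>i\<in>UNIV. (s *\<^sub>R v) $ i * partial_deriv i u (q t))) (at t)"
    using assms(2) unfolding has_vector_derivative_def
    by (rule has_derivative_compose) (rule has_derivative_partial_deriv[OF assms(1)])
  moreover have "(\<lambda>s. \<Sum>i\<in>UNIV. (s *\<^sub>R v) $ i * partial_deriv i u (q t)) =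
      (*) (v $ 1 * partial_deriv 1 u (q t) + v $ 2 * partial_deriv 2 u (q t))"
    by (auto simp: fun_eq_iff UNIV_2 algebra_simps)
  ultimately show ?thesis by (simp only: has_field_derivative_def)
qed

lemma has_real_derivative_radial:
  fixes u :: "real ^ 2 \<Rightarrow> real"
  assumes "smooth_on UNIV u"
  shows "((\<lambda>r. u (p + r *\<^sub>R unit_vec t)) has_real_derivative
    cos t * partial_deriv 1 u (p + r *\<^sub>R unit_vec t) + sin t * partial_deriv 2 u (p + r *\<^sub>R unit_vec t)) (at r)"
  using smooth_on_differentiable[OF assms]
  by (rule chain_rule_curve[where v = "unit_vec t", simplified])
     (auto intro!: derivative_eq_intros simp: has_vector_derivative_def)

lemma has_real_derivative_angular:
  fixes u :: "real ^ 2 \<Rightarrow> real"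
  assumes "smooth_on UNIV u"
  shows "((\<lambda>t. u (p + r *\<^sub>R unit_vec t)) has_real_derivative
    r * (cos t * partial_deriv 2 u (p + r *\<^sub>R unit_vec t) - sin t * partial_deriv 1 u (p + r *\<^sub>R unit_vec t))) (at t)"
proof -
  have "((\<lambda>t. p + r *\<^sub>R unit_vec t) has_vector_derivative r *\<^sub>R unit_vec (t + pi / 2)) (at t)"
    by (auto intro!: derivative_eq_intros has_vector_derivative_unit_vec)
  from chain_rule_curve[OF smooth_on_differentiable[OF assms] this] show ?thesis
    by (simp add: cos_add sin_add algebra_simps)
qed

text \<open>
  The integral formula for \<open>\<partial>\<^sub>r M f\<close>, obtained by differentiating under the integral sign.
\<close>

definition radial_slope :: "(real ^ 2 \<Rightarrow> real) \<Rightarrow> real ^ 2 \<Rightarrow> real \<Rightarrow> real" where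
  "radial_slope f p r = 1 / (2 * pi) * integral {0..2 * pi} (\<lambda>t.
     cos t * partial_deriv 1 f (p + r *\<^sub>R unit_vec t) + sin t * partial_deriv 2 f (p + r *\<^sub>R unit_vec t))"

lemma continuous_on_smooth_compose:
  assumes "smooth_on UNIV (u :: real ^ 2 \<Rightarrow> real)" "continuous_on S q"
  shows "continuous_on S (\<lambda>x. u (q x))"
  using continuous_on_compose2[OF smooth_on_continuous_on[OF assms(1)] assms(2)] by auto

lemma circular_mean_has_derivative:
  assumes f: "smooth_on UNIV f"
  shows "(circular_mean f p has_real_derivative radial_slope f p r) (at r)"
proof -
  note p = smooth_on_partial_deriv[OF f]
  have "((\<lambda>r. integral (cbox 0 (2 * pi)) (\<lambda>t. f (p + r *\<^sub>R unit_vec t))) has_field_derivative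
     integral (cbox 0 (2 * pi)) (\<lambda>t. cos t * partial_deriv 1 f (p + r *\<^sub>R unit_vec t) + sin t * partial_deriv 2 f (p + r *\<^sub>R unit_vec t)))
     (at r within UNIV)"
  proof (rule leibniz_rule_field_derivative)
    show "(\<lambda>t. f (p + r *\<^sub>R unit_vec t)) integrable_on cbox 0 (2 * pi)" for r
      by (intro integrable_continuous continuous_on_smooth_compose[OF f] continuous_intros)
    show "continuous_on (UNIV \<times> cbox 0 (2 * pi)) (\<lambda>(r, t).
        cos t * partial_deriv 1 f (p + r *\<^sub>R unit_vec t) + sin t * partial_deriv 2 f (p + r *\<^sub>R unit_vec t))"
      unfolding case_prod_beta' by (intro continuous_intros continuous_on_smooth_compose[OF p])
  qed (use has_real_derivative_radial[OF f] in auto)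
  from DERIV_cmult[OF this, of "1 / (2 * pi)"] show ?thesis
    unfolding radial_slope_def
    by (simp add: circular_mean_eq_integral[OF smooth_on_continuous_on[OF f], abs_def])
qed

lemma continuous_on_radial_slope:
  assumes f: "smooth_on UNIV f"
  shows "continuous_on S (radial_slope f p)"
proof -
  note p = smooth_on_partial_deriv[OF f]
  have "continuous_on S (\<lambda>r. integral (cbox 0 (2 * pi)) (\<lambda>t.
     cos t * partial_deriv 1 f (p + r *\<^sub>R unit_vec t) + sin t * partial_deriv 2 f (p + r *\<^sub>R unit_vec t)))"
    by (rule integral_continuous_on_param)
       (unfold case_prod_beta', intro continuous_intros continuous_on_smooth_compose[OF p])
  then show ?thesis unfolding radial_slope_def by (intro continuous_intros) simp
qed

text \<open>
  Write \<open>F(r,t) = f(p + r e(t))\<close>. The Laplacian in polar coordinates, multiplied by \<open>r\<close>, reads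
  \<open>r (\<Delta> f)(p + r e(t)) = \<partial>\<^sub>r (r \<partial>\<^sub>r F) + \<partial>\<^sub>t A\<close>, where \<open>A = (\<partial>\<^sub>t F) / r\<close> is the tangential derivative of \<open>f\<close>. This form is free
  of division by \<open>r\<close>, hence valid at \<open>r = 0\<close>, and the periodic function \<open>A\<close> disappears upon integration
  over \<open>t\<close>.
\<close>

lemma circular_mean_darboux:
  assumes f: "smooth_on UNIV f"
  shows "((\<lambda>r. r * radial_slope f p r) has_real_derivative r * circular_mean (laplacian f) p r) (at r)"
proof -
  note p = smooth_on_partial_deriv[OF f]
  note pp = smooth_on_partial_deriv[OF p]
  let ?q = "\<lambda>r t. p + r *\<^sub>R unit_vec t"
  define S where "S = (\<lambda>r t. cos t * partial_deriv 1 f (?q r t) + sin t * partial_deriv 2 f (?q r t))"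
  define A where "A = (\<lambda>t. cos t * partial_deriv 2 f (?q r t) - sin t * partial_deriv 1 f (?q r t))"
  define H where "H = (\<lambda>r t. cos t * (cos t * partial_deriv 1 (partial_deriv 1 f) (?q r t) + sin t * partial_deriv 2 (partial_deriv 1 f) (?q r t))
      + sin t * (cos t * partial_deriv 1 (partial_deriv 2 f) (?q r t) + sin t * partial_deriv 2 (partial_deriv 2 f) (?q r t)))"
  have "((\<lambda>r. integral (cbox 0 (2 * pi)) (\<lambda>t. r * S r t)) has_field_derivative
     integral (cbox 0 (2 * pi)) (\<lambda>t. S r t + r * H r t)) (at r within UNIV)"
  proof (rule leibniz_rule_field_derivative)
    show "(\<lambda>t. r * S r t) integrable_on cbox 0 (2 * pi)" for r
      unfolding S_def by (intro integrable_continuous continuous_intros continuous_on_smooth_compose[OF p])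
    show "continuous_on (UNIV \<times> cbox 0 (2 * pi)) (\<lambda>(r, t). S r t + r * H r t)"
      unfolding case_prod_beta' S_def H_def
      by (intro continuous_intros continuous_on_smooth_compose[OF p] continuous_on_smooth_compose[OF pp])
    fix r t
    have "((\<lambda>r. S r t) has_real_derivative H r t) (at r)"
      unfolding S_def H_def by (intro DERIV_add DERIV_cmult has_real_derivative_radial p)
    from DERIV_mult[OF DERIV_ident this]
    show "((\<lambda>r. r * S r t) has_real_derivative S r t + r * H r t) (at r within UNIV)"
      by (simp add: algebra_simps)
  qed auto
  then have der: "((\<lambda>r. r * integral {0..2 * pi} (S r)) has_real_derivative
     integral {0..2 * pi} (\<lambda>t. S r t + r * H r t)) (at r)"
    by simp
  have "(A has_vector_derivative r * laplacian f (?q r t) - (S r t + r * H r t)) (at t within {0..2 * pi})" for t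
  proof -
    have "(A has_real_derivative
        (cos t * (r * (cos t * partial_deriv 2 (partial_deriv 2 f) (?q r t) - sin t * partial_deriv 1 (partial_deriv 2 f) (?q r t)))
           + (- sin t) * partial_deriv 2 f (?q r t))
        - (sin t * (r * (cos t * partial_deriv 2 (partial_deriv 1 f) (?q r t) - sin t * partial_deriv 1 (partial_deriv 1 f) (?q r t)))
           + cos t * partial_deriv 1 f (?q r t))) (at t)"
      unfolding A_def
      by (intro DERIV_diff DERIV_mult' DERIV_cos DERIV_sin has_real_derivative_angular p)
    also have "(cos t * (r * (cos t * partial_deriv 2 (partial_deriv 2 f) (?q r t) - sin t * partial_deriv 1 (partial_deriv 2 f) (?q r t)))
           + (- sin t) * partial_deriv 2 f (?q r t))
        - (sin t * (r * (cos t * partial_deriv 2 (partial_deriv 1 f) (?q r t) - sin t * partial_deriv 1 (partial_deriv 1 f) (?q r t)))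
           + cos t * partial_deriv 1 f (?q r t)) =
        r * (((cos t)\<^sup>2 + (sin t)\<^sup>2) * laplacian f (?q r t)) - (S r t + r * H r t)"
      by (simp add: laplacian_def UNIV_2 S_def H_def power2_eq_square algebra_simps
          del: sin_cos_squared_add sin_cos_squared_add2 sin_cos_squared_add3)
    finally show ?thesis
      by (auto simp: has_real_derivative_iff_has_vector_derivative intro: has_vector_derivative_at_within)
  qed
  then have "((\<lambda>t. r * laplacian f (?q r t) - (S r t + r * H r t)) has_integral (A (2 * pi) - A 0)) {0..2 * pi}"
    by (intro fundamental_theorem_of_calculus) auto
  moreover have "A (2 * pi) = A 0" by (simp add: A_def unit_vec_def)
  ultimately have "integral {0..2 * pi} (\<lambda>t. r * laplacian f (?q r t) - (S r t + r * H r t)) = 0"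
    by (simp add: has_integral_iff)
  moreover have "integral {0..2 * pi} (\<lambda>t. r * laplacian f (?q r t) - (S r t + r * H r t)) =
      integral {0..2 * pi} (\<lambda>t. r * laplacian f (?q r t)) - integral {0..2 * pi} (\<lambda>t. S r t + r * H r t)"
    unfolding S_def H_def
    by (intro integral_diff integrable_continuous_real continuous_intros continuous_on_smooth_compose[OF p] continuous_on_smooth_compose[OF pp]
        continuous_on_compose2[OF smooth_on_continuous_on_laplacian[OF f]]) auto
  ultimately have "integral {0..2 * pi} (\<lambda>t. S r t + r * H r t) = r * integral {0..2 * pi} (\<lambda>t. laplacian f (?q r t))"
    by simp
  moreover have "(\<lambda>r. r * radial_slope f p r) = (\<lambda>r. 1 / (2 * pi) * (r * integral {0..2 * pi} (S r)))"
    by (simp add: radial_slope_def S_def)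
  ultimately show ?thesis
    using DERIV_cmult[OF der, of "1 / (2 * pi)"]
    by (simp add: circular_mean_eq_integral[OF smooth_on_continuous_on_laplacian[OF f]])
qed

text \<open>
  The one-sided derivative is unique because no point of the half-line is isolated, so it agrees with the
  ordinary derivative of any extension.
\<close>

lemma radial_deriv_eq:
  assumes "\<And>r. r \<ge> 0 \<Longrightarrow> g r = h r" "(h has_real_derivative d) (at r)" "r \<ge> 0"
  shows "radial_deriv g r = d"
proof -
  have "(h has_vector_derivative d) (at r within {0..})"
    using assms(2) by (auto simp: has_real_derivative_iff_has_vector_derivative intro: has_vector_derivative_at_within)
  then have "(g has_vector_derivative d) (at r within {0..})"
    by (rule has_vector_derivative_transform[rotated 2]) (use assms in auto)
  moreover have "r islimpt {0..}"
  proof (rule connected_imp_perfect)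
    show "{0..} \<noteq> {a}" for a :: real
      by (metis atLeast_iff order_refl singletonD zero_le_one zero_neq_one)
  qed (use assms(3) in auto)
  ultimately show ?thesis
    unfolding radial_deriv_def by (intro vector_derivative_within) (auto simp: trivial_limit_within)
qed

lemma dr_r_dr_circular_mean:
  assumes f: "smooth_on UNIV f" and r: "r \<ge> 0"
  shows "dr_r_dr (circular_mean f p) r = r * circular_mean (laplacian f) p r"
proof -
  have "radial_deriv (circular_mean f p) r = radial_slope f p r" if "r \<ge> 0" for r
    using circular_mean_has_derivative[OF f] that by (intro radial_deriv_eq[where h = "circular_mean f p"]) auto
  then show ?thesis
    unfolding dr_r_dr_def using r
    by (intro radial_deriv_eq[OF _ circular_mean_darboux[OF f]]) auto
qed

text \<open>
  By the Darboux equation, \<open>r M(\<Delta> f) ln (R r)\<close> is the derivative of \<open>r ln (R r) \<partial>\<^sub>r M f - M f\<close>. This function of \<open>r\<close>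
  vanishes for large \<open>r\<close> and tends to \<open>- f x\<close> as \<open>r\<close> tends to \<open>0\<close>.
\<close>

lemma log_potential_laplacian:
  assumes f: "smooth_on UNIV f" and supp: "\<And>y. norm y > R \<Longrightarrow> f y = 0" and R: "R > 0"
  shows "log_potential R (laplacian f) x = 2 * pi * f x"
proof -
  \<comment> \<open>Every point at distance at least \<open>B\<close> from \<open>x\<close> lies strictly outside the support.\<close>
  define B where "B = R + norm x + 1"
  have B: "B > 0" using R by (simp add: B_def add_pos_nonneg)
  have cf: "continuous_on UNIV f" and cl: "continuous_on UNIV (laplacian f)"
    using f by (simp_all add: smooth_on_continuous_on smooth_on_continuous_on_laplacian)
  have out: "norm y > R" if "norm (y - x) \<ge> B" for y
    using that norm_triangle_ineq4[of y x] by (simp add: B_def)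
  have outB: "norm (x + B *\<^sub>R unit_vec t) > R" for t
    using B by (intro out) simp
  have supl: "laplacian f y = 0" if "norm (y - x) > B" for y
    using out[of y] that by (intro laplacian_eq_0_outside[of R f] supp) auto
  note w = radial_weight_integral(2,3)[where p = x, OF cl _ set_integrable_ln_cmult[OF R] less_imp_le[OF B] supl]
  let ?F = "\<lambda>r. r * ln (R * r) * radial_slope f x r - circular_mean f x r"
  have "((\<lambda>r. r * circular_mean (laplacian f) x r * ln \<bar>R * r\<bar>) has_integral (?F B - ?F 0)) {0..B}"
  proof (rule fundamental_theorem_of_calculus_interior)
    have c: "continuous_on {0..B} (circular_mean f x)"
      by (intro continuous_at_imp_continuous_on ballI DERIV_isCont[OF circular_mean_has_derivative[OF f]])
    \<comment> \<open>The logarithm is split off to reduce continuity at \<open>0\<close> to that of \<open>r ln r\<close>; at \<open>r = 0\<close> both forms are \<open>- f x\<close>.\<close>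
    have "continuous_on {0..B} (\<lambda>r. ln R * r * radial_slope f x r + r * ln r * radial_slope f x r - circular_mean f x r)"
      by (intro continuous_intros c continuous_on_radial_slope f continuous_on_subset[OF continuous_on_x_ln]) auto
    moreover have "ln R * r * radial_slope f x r + r * ln r * radial_slope f x r - circular_mean f x r = ?F r" if "r \<in> {0..B}" for r
      using that R by (cases "r = 0") (simp_all add: ln_mult algebra_simps)
    ultimately show "continuous_on {0..B} ?F" by (rule continuous_on_eq)
    fix r assume r: "r \<in> {0<..<B}"
    have "((\<lambda>r. ln (R * r)) has_real_derivative 1 / r) (at r)"
      using r R by (auto intro!: derivative_eq_intros)
    from DERIV_diff[OF DERIV_mult'[OF this circular_mean_darboux[OF f, of x r]] circular_mean_has_derivative[OF f, of x r]]
    show "(?F has_vector_derivative r * circular_mean (laplacian f) x r * ln \<bar>R * r\<bar>) (at r)"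
      using r R by (simp add: has_real_derivative_iff_has_vector_derivative[symmetric] abs_mult mult_ac)
  qed (use B in auto)
  moreover have "circular_mean f x B = 0" "radial_slope f x B = 0"
    using supp[OF outB] partial_deriv_eq_0_outside[of R f, OF supp outB]
    by (simp_all add: circular_mean_eq_integral[OF cf] radial_slope_def)
  moreover have "circular_mean f x 0 = f x"
    by (simp add: circular_mean_eq_integral[OF cf])
  ultimately have "integral {0..B} (\<lambda>r. r * circular_mean (laplacian f) x r * ln \<bar>R * r\<bar>) = f x"
    by (simp add: has_integral_iff)
  with set_borel_integral_eq_integral(2)[OF w(1)]
  have "(LBINT r:{0..B}. r * circular_mean (laplacian f) x r * ln \<bar>R * r\<bar>) = f x" by simp
  then have "(\<integral>y. laplacian f y * ln \<bar>R * norm (y - x)\<bar> \<partial>lborel) = 2 * pi * f x"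
    using w(2) by (simp add: field_simps)
  then show ?thesis
    using R by (subst log_potential_eq) (simp_all add: abs_mult cl borel_measurable_continuous_onI)
qed

text \<open>
  Compares the indicator function of a ball with a continuous compactly supported function.
\<close>

lemma ln_norm_locally_integrable:
  fixes R :: real
  assumes R: "R > 0"
  shows "set_integrable lborel (cball 0 B) (\<lambda>z :: real ^ 2. c * ln (R * norm z))"
proof -
  \<comment> \<open>A continuous function with compact support that is at least \<open>1\<close> on \<open>cball 0 B\<close>.\<close>
  define g where "g = (\<lambda>y :: real ^ 2. max 0 (\<bar>B\<bar> + 1 - norm y))"
  have "integrable lborel (\<lambda>y. g y * ln (R * norm (y - 0)))"
    by (rule ln_norm_integrable[where B = "\<bar>B\<bar> + 1"]) (auto simp: g_def R intro!: continuous_intros)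
  then have "integrable lborel (\<lambda>y. c * (g y * ln (R * norm y)))" by simp
  then show ?thesis
    unfolding set_integrable_def
  proof (rule Bochner_Integration.integrable_bound)
    have "norm (indicator (cball 0 B) z *\<^sub>R (c * ln (R * norm z))) \<le> norm (c * (g z * ln (R * norm z)))" for z :: "real ^ 2"
    proof (cases "norm z \<le> B")
      case True
      then have "1 \<le> g z" by (simp add: g_def)
      then have "1 * \<bar>c * ln (R * norm z)\<bar> \<le> g z * \<bar>c * ln (R * norm z)\<bar>" by (intro mult_right_mono) auto
      with True \<open>1 \<le> g z\<close> show ?thesis by (simp add: abs_mult mult_ac)
    qed simp
    then show "AE z in lborel. norm (indicator (cball 0 B) z *\<^sub>R (c * ln (R * norm z))) \<le> norm (c * (g z * ln (R * norm z)))"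
      by simp
  next
    have [measurable]: "cball 0 B \<in> sets (borel :: (real ^ 2) measure)" by simp
    show "(\<lambda>z :: real ^ 2. indicator (cball 0 B) z *\<^sub>R (c * ln (R * norm z))) \<in> borel_measurable lborel"
      by measurable
  qed
qed

theorem theorem1:
  fixes f :: "real ^ 2 \<Rightarrow> real" and R0 :: real
  assumes "R0 > 0"
    and "smooth_on UNIV f"
    and "closure {y. f y \<noteq> 0} \<subseteq> cball 0 R0"
  shows
    "(\<forall>x\<in>ball 0 R0. iterated_integrable R0
        (\<lambda>p r. r * circular_mean f p r * ln \<bar>r\<^sup>2 - (norm (x - p))\<^sup>2\<bar>)) \<and>
     Ck_on 2 (ball 0 R0)
       (\<lambda>x. LINT p|circle_arc_length R0. (LBINT r:{0..2 * R0}.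
              (r * circular_mean f p r * ln \<bar>r\<^sup>2 - (norm (x - p))\<^sup>2\<bar>))) \<and>
     (\<forall>x\<in>ball 0 R0.
        f x = 1 / (2 * pi * R0) *
          laplacian (\<lambda>x. LINT p|circle_arc_length R0. (LBINT r:{0..2 * R0}.
              (r * circular_mean f p r * ln \<bar>r\<^sup>2 - (norm (x - p))\<^sup>2\<bar>))) x) \<and>
     (\<forall>x\<in>ball 0 R0. iterated_integrable R0
        (\<lambda>p r. dr_r_dr (circular_mean f p) r * ln \<bar>r\<^sup>2 - (norm (x - p))\<^sup>2\<bar>)) \<and>
     (\<forall>x\<in>ball 0 R0.
        f x = 1 / (2 * pi * R0) *
          (LINT p|circle_arc_length R0. (LBINT r:{0..2 * R0}.
              (dr_r_dr (circular_mean f p) r * ln \<bar>r\<^sup>2 - (norm (x - p))\<^sup>2\<bar>))))"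
proof -
  note R = assms(1) and f = assms(2)
  have supp: "f y = 0" if "norm y > R0" for y
    using that assms(3) closure_subset[of "{y. f y \<noteq> 0}"] by (auto simp: subset_iff)
  have cf: "continuous_on UNIV f" and cl: "continuous_on UNIV (laplacian f)"
    using f by (simp_all add: smooth_on_continuous_on smooth_on_continuous_on_laplacian)
  have suppl: "laplacian f y = 0" if "norm y > R0" for y
    using laplacian_eq_0_outside[of R0 f, OF supp that] .
  \<comment> \<open>With the factor \<open>R0\<close> in the kernel, both double integrals are themselves kernel integrals.\<close>
  define W where "W = (\<lambda>z :: real ^ 2. R0 * ln (R0 * norm z))"
  have W: "\<And>B. set_integrable lborel (cball 0 B) W" "W \<in> borel_measurable borel"
    unfolding W_def using ln_norm_locally_integrable[OF R] by simp_all
  have WP: "R0 * log_potential R0 g x = kernel_integral W g x" for g x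
    by (simp add: log_potential_def kernel_integral_def W_def mult.assoc)
  let ?G = "\<lambda>x. LINT p|circle_arc_length R0. (LBINT r:{0..2 * R0}.
              (r * circular_mean f p r * ln \<bar>r\<^sup>2 - (norm (x - p))\<^sup>2\<bar>))"
  have G: "?G x = kernel_integral W f x" if "x \<in> ball 0 R0" for x
    using circular_mean_log_integral(2)[OF R cf supp that] WP by simp
  have smooth: "Ck_on 2 (ball 0 R0) (kernel_integral W f)"
    using kernel_integral_smooth[OF W f supp] Ck_on_subset[of 2 UNIV _ "ball 0 R0"] by (auto simp: smooth_on_def)
  have pot: "kernel_integral W (laplacian f) x = 2 * pi * R0 * f x" for x
  proof -
    have "kernel_integral W (laplacian f) x = R0 * log_potential R0 (laplacian f) x" by (simp only: WP)
    also have "\<dots> = 2 * pi * R0 * f x" using log_potential_laplacian[OF f supp R, of x] by simp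
    finally show ?thesis .
  qed
  have dr: "dr_r_dr (circular_mean f p) r = r * circular_mean (laplacian f) p r" if "r \<in> {0..2 * R0}" for p r
    using dr_r_dr_circular_mean[OF f] that by simp
  have eq: "(LBINT r:{0..2 * R0}. dr_r_dr (circular_mean f p) r * ln \<bar>r\<^sup>2 - (norm (x - p))\<^sup>2\<bar>) =
      (LBINT r:{0..2 * R0}. r * circular_mean (laplacian f) p r * ln \<bar>r\<^sup>2 - (norm (x - p))\<^sup>2\<bar>)" for x p
    by (intro set_lebesgue_integral_cong) (auto simp: dr)
  have eqi: "set_integrable lborel {0..2 * R0} (\<lambda>r. dr_r_dr (circular_mean f p) r * ln \<bar>r\<^sup>2 - (norm (x - p))\<^sup>2\<bar>) \<longleftrightarrow>
      set_integrable lborel {0..2 * R0} (\<lambda>r. r * circular_mean (laplacian f) p r * ln \<bar>r\<^sup>2 - (norm (x - p))\<^sup>2\<bar>)" for x p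
    by (intro set_integrable_cong) (auto simp: dr)
  show ?thesis
  proof (intro conjI ballI)
    show "Ck_on 2 (ball 0 R0) ?G" by (rule Ck_on_cong_open[OF open_ball G smooth])
    fix x :: "real ^ 2" assume x: "x \<in> ball 0 R0"
    show "iterated_integrable R0 (\<lambda>p r. r * circular_mean f p r * ln \<bar>r\<^sup>2 - (norm (x - p))\<^sup>2\<bar>)"
      by (rule circular_mean_log_integral(1)[OF R cf supp x])
    have "laplacian ?G x = 2 * pi * R0 * f x"
      using laplacian_cong_open[OF open_ball x G smooth] kernel_integral_laplacian[OF W f supp] pot by simp
    then show "f x = 1 / (2 * pi * R0) * laplacian ?G x" using R by simp
    show "iterated_integrable R0 (\<lambda>p r. dr_r_dr (circular_mean f p) r * ln \<bar>r\<^sup>2 - (norm (x - p))\<^sup>2\<bar>)"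
      using circular_mean_log_integral(1)[OF R cl suppl x] by (simp add: iterated_integrable_def eq eqi)
    show "f x = 1 / (2 * pi * R0) * (LINT p|circle_arc_length R0. (LBINT r:{0..2 * R0}.
              (dr_r_dr (circular_mean f p) r * ln \<bar>r\<^sup>2 - (norm (x - p))\<^sup>2\<bar>)))"
      using circular_mean_log_integral(2)[OF R cl suppl x] WP pot R by (simp add: eq)
  qed
qed

end
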